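(* Let $p\in(0,1)$ and let $T_n$ be the number of triangles in the Erdős--Rényi random graph $G(n,p)$. Let $p_0=2/(2+e^{3/2})$. (a) If $p>p_0$, then for any $r\in(p,1]$, $$\mathbb{P}\Bigl(T_n\ge\binom n3 r^3\Bigr)=\exp\Bigl(-\frac{n^2I(r,p)}{2}\bigl(1+O(n^{-1/2})\bigr)\Bigr).$$ (b) If $p\le p_0$, there exist $p',p''$ (depending on $p$) with $p<p'\le p''<1$ such that for all $r\in(p,p')\cup(p'',1]$, $$\mathbb{P}\Bigl(T_n\ge\binom n3 r^3\Bigr)=\exp\Bigl(-\frac{n^2I(r,p)}{2}\bigl(1+O(n^{-1/2})\bigr)\Bigr).$$ (c) Whenever $p>p_0$ and $r\in(p,1]$, or $p\le p_0$ and $r\in(p,p')\cup(p'',1]$ (with $p',p''$ as in (b)), there is also a constant $C(p,r)$ depending only on $p$ and $r$ such that $$\mathbb{P}\Bigl(\Bigl|T_n-\binom n3r^3\Bigr|\le C(p,r)\,n^{5/2}\Bigr)=\exp\Bigl(-\frac{n^2I(r,p)}{2}\bigl(1+O(n^{-1/2})\bigr)\Bigr).$$ Here $p$ and $r$ are fixed, $n\to\infty$, and the implied constants in $O(\cdot)$ may depend on $p$ and $r$.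
   Context: $G(n,p)$ is the random graph on vertex set $\{1,\dots,n\}$ in which each edge is present independently with probability $p$. A triangle is a triple $i<j<k$ all of whose three edges are present. For $r,s\in(0,1)$, $I(r,s):=r\log\frac rs+(1-r)\log\frac{1-r}{1-s}$, and $I(1,s):=\log(1/s)$ (extension by continuity). *)

theory Defs
  imports "HOL-Probability.Probability" "HOL-Library.Landau_Symbols"
begin

definition vertex_pairs :: "nat \<Rightarrow> nat set set" where
  "vertex_pairs n = {e. e \<subseteq> {1..n} \<and> card e = 2}"

text \<open>A graph on \<open>{1..n}\<close> is represented by the indicator function of its edge set,
  which is \<^const>\<open>False\<close> outside \<open>vertex_pairs n\<close>.\<close>

definition gnp :: "nat \<Rightarrow> real \<Rightarrow> (nat set \<Rightarrow> bool) pmf" where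
  "gnp n p = Pi_pmf (vertex_pairs n) False (\<lambda>_. bernoulli_pmf p)"

definition num_triangles :: "nat \<Rightarrow> (nat set \<Rightarrow> bool) \<Rightarrow> nat" where
  "num_triangles n g =
     card {(i, j, k). 1 \<le> i \<and> i < j \<and> j < k \<and> k \<le> n \<and> g {i, j} \<and> g {j, k} \<and> g {i, k}}"

definition rel_ent :: "real \<Rightarrow> real \<Rightarrow> real" where
  "rel_ent r s =
     (if r = 1 then ln (1 / s) else r * ln (r / s) + (1 - r) * ln ((1 - r) / (1 - s)))"

definition p_crit :: real where
  "p_crit = 2 / (2 + exp (3 / 2))"

definition upper_tail_prob :: "real \<Rightarrow> real \<Rightarrow> nat \<Rightarrow> real" where
  "upper_tail_prob p r n =
     measure_pmf.prob (gnp n p) {g. real (num_triangles n g) \<ge> real (n choose 3) * r ^ 3}"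

definition window_prob :: "real \<Rightarrow> real \<Rightarrow> real \<Rightarrow> nat \<Rightarrow> real" where
  "window_prob p r C n =
     measure_pmf.prob (gnp n p)
       {g. \<bar>real (num_triangles n g) - real (n choose 3) * r ^ 3\<bar> \<le> C * real n powr (5 / 2)}"

text \<open>\<open>P n = exp (- (n^2 a / 2) (1 + O(n powr (-1/2))))\<close> as \<open>n \<rightarrow> \<infinity>\<close>.\<close>

definition exp_decay :: "(nat \<Rightarrow> real) \<Rightarrow> real \<Rightarrow> bool" where
  "exp_decay P a \<longleftrightarrow>
     (\<exists>\<epsilon> :: nat \<Rightarrow> real. \<epsilon> \<in> O(\<lambda>n. real n powr (- 1 / 2)) \<and>
        (\<forall>\<^sub>F n in sequentially. P n = exp (- (real n ^ 2 * a / 2) * (1 + \<epsilon> n))))"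

end

theory Submission
  imports Defs
begin

text \<open>Upper bound: let \<open>A\<close> be the event, conditioned on which the edge indicators are
  exchangeable, and let \<open>q(e)\<close> be the conditional probability of the edge \<open>e\<close> given all edges whose
  smaller endpoint precedes that of \<open>e\<close>. Gibbs' inequality bounds \<open>- ln P(A)\<close> below by the sum over \<open>e\<close> of
  \<open>E (rel_ent (q(e)) p)\<close>, and where the graph of \<open>x \<mapsto> rel_ent (root 3 x) p\<close> lies above its tangent at
  \<open>r ^ 3\<close> this is controlled by \<open>E (q(e) ^ 3)\<close>. By exchangeability and AM-GM, \<open>E (q ^ 3)\<close> is at least the
  triangle density minus twice the L2 increment of the martingale \<open>q\<close> when one more vertex is
  revealed. The squared increments telescope to at most 1, so Cauchy-Schwarz bounds the total loss
  by a multiple of \<open>n powr (3/2)\<close>.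

  Lower bound: tilt the edge density to \<open>r + n powr (-1/2)\<close> and apply Chebyshev's inequality to the
  numbers of triangles and of edges.

  The tangent condition holds for all \<open>r\<close> when \<open>p > p_crit\<close>, and for \<open>r\<close> near \<open>p\<close> or near 1 otherwise.\<close>

subsection \<open>Conditional expectation on a finite weighted set\<close>

text \<open>A relative error \<open>n powr (-1/2)\<close> in an exponent of order
  \<open>n ^ 2\<close> leaves room for a loss of order \<open>n powr (3/2)\<close> in the logarithm,
  and both bounds spend just that. The graph is revealed vertex by vertex, not edge by edge: given
  the edges with smaller endpoint below \<open>m\<close>, the vertices \<open>{m..n}\<close> are
  still exchangeable. All pairs among them then have conditional probabilities with one common law,
  a single reference edge \<open>{n - 1, n}\<close> measures the loss at every step, and at most
  \<open>n\<close> edges share each loss.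

  The cube appears because a triangle is a product of three edge indicators. In the coordinate
  \<open>q ^ 3\<close> the entropy is convex where
  \<open>2 * rel_ent_deriv p q \<le> 1 / (1 - q)\<close>. The difference of the two sides is largest
  at \<open>q = 2/3\<close>, where it vanishes precisely for \<open>p = p_crit\<close>. For smaller
  \<open>p\<close> convexity fails near \<open>2/3\<close>, but a tangent taken close to either end
  can still stay below the whole graph.

  The value \<open>r = 1\<close> is treated apart: the tilted density would leave the unit interval,
  and the slope of the tangent tends to infinity there.\<close>

definition cexp :: "('a \<Rightarrow> real) \<Rightarrow> 'a set \<Rightarrow> ('a \<Rightarrow> 'b) \<Rightarrow> ('a \<Rightarrow> real) \<Rightarrow> 'a \<Rightarrow> real" where
  "cexp w A k f x = (\<Sum>y\<in>{y\<in>A. k y = k x}. w y * f y) / (\<Sum>y\<in>{y\<in>A. k y = k x}. w y)"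

lemma cexp_cong_key: "k x = k y \<Longrightarrow> cexp w A k f x = cexp w A k f y"
  by (simp add: cexp_def)

text \<open>The fibres of \<open>k\<close> are the atoms of the conditioning algebra, and
  \<open>g\<close> is measurable when it is constant on them. After the sums over \<open>x\<close>
  and \<open>y\<close> are exchanged, the weights in the fibre of \<open>y\<close> add up to
  \<open>W y\<close> and cancel the denominator.\<close>

lemma cexp_tower:
  assumes A: "finite A" "\<And>x. x \<in> A \<Longrightarrow> 0 < w x"
    and g: "\<And>x y. x \<in> A \<Longrightarrow> y \<in> A \<Longrightarrow> k x = k y \<Longrightarrow> g x = g y"
  shows "(\<Sum>x\<in>A. w x * (g x * cexp w A k f x)) = (\<Sum>x\<in>A. w x * (g x * f x))"
proof -
  define W where "W x = (\<Sum>y\<in>{y\<in>A. k y = k x}. w y)" for x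
  have Wpos: "W x > 0" if "x \<in> A" for x
    unfolding W_def using A that by (intro sum_pos) auto
  have "(\<Sum>x\<in>A. w x * (g x * cexp w A k f x))
      = (\<Sum>x\<in>A. \<Sum>y\<in>{y\<in>A. k y = k x}. w x * g x / W x * (w y * f y))"
    unfolding cexp_def W_def[symmetric]
    unfolding sum_distrib_left[symmetric] by (intro sum.cong refl) simp
  also have "\<dots> = (\<Sum>x\<in>A. \<Sum>y\<in>A. if k y = k x then w x * g x / W x * (w y * f y) else 0)"
    by (intro sum.cong refl sum.inter_filter[OF A(1)])
  also have "\<dots> = (\<Sum>y\<in>A. \<Sum>x\<in>A. if k y = k x then w x * g x / W x * (w y * f y) else 0)"
    by (rule sum.swap)
  also have "\<dots> = (\<Sum>y\<in>A. \<Sum>x\<in>A. if k x = k y then w x * (g y / W y * (w y * f y)) else 0)"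
    by (intro sum.cong refl) (auto simp: W_def dest: g)
  also have "\<dots> = (\<Sum>y\<in>A. W y * (g y / W y * (w y * f y)))"
    by (simp only: W_def sum_distrib_right sum.inter_filter[OF A(1), symmetric])
  also have "\<dots> = (\<Sum>x\<in>A. w x * (g x * f x))"
    by (intro sum.cong refl) (use Wpos in \<open>force simp: field_simps\<close>)
  finally show ?thesis .
qed

lemma cexp_bounds:
  assumes A: "finite A" "\<And>x. x \<in> A \<Longrightarrow> 0 < w x"
    and f: "\<And>x. x \<in> A \<Longrightarrow> 0 \<le> f x \<and> f x \<le> 1"
  shows "0 \<le> cexp w A k f x" "cexp w A k f x \<le> 1"
proof -
  have *: "(\<Sum>y\<in>{y\<in>A. k y = k x}. w y * f y) \<le> (\<Sum>y\<in>{y\<in>A. k y = k x}. w y)"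
    using A f by (intro sum_mono) (auto simp: mult_left_le less_imp_le)
  have "0 \<le> (\<Sum>y\<in>{y\<in>A. k y = k x}. w y * f y)"
    using A f by (intro sum_nonneg) (auto simp: less_imp_le)
  with * show "0 \<le> cexp w A k f x" "cexp w A k f x \<le> 1"
    by (auto simp: cexp_def divide_le_eq_1)
qed

text \<open>Positivity at an outcome where \<open>f\<close> itself is positive guarantees positive
  arguments for the logarithms in the entropy bound.\<close>

lemma cexp_pos:
  assumes A: "finite A" "\<And>x. x \<in> A \<Longrightarrow> 0 < w x"
    and f: "\<And>x. x \<in> A \<Longrightarrow> 0 \<le> f x" and x: "x \<in> A" "0 < f x"
  shows "0 < cexp w A k f x"
  unfolding cexp_def using assms
  by (intro divide_pos_pos sum_pos sum_pos2[where i = x]) (auto simp: less_imp_le)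

lemma cexp_one_minus:
  assumes A: "finite A" "\<And>x. x \<in> A \<Longrightarrow> 0 < w x" and x: "x \<in> A"
  shows "cexp w A k (\<lambda>y. 1 - f y) x = 1 - cexp w A k f x"
proof -
  have "(\<Sum>y\<in>{y\<in>A. k y = k x}. w y) > 0"
    using A x by (intro sum_pos) auto
  thus ?thesis
    by (simp add: cexp_def right_diff_distrib sum_subtractf diff_divide_distrib)
qed

text \<open>Pythagoras for one martingale step: by the tower property at both levels, the mixed
  moment of the two estimates equals the second moment of the coarser one.\<close>

lemma cexp_increment:
  assumes A: "finite A" "\<And>x. x \<in> A \<Longrightarrow> 0 < w x"
    and kk: "\<And>x y. k' x = k' y \<Longrightarrow> k x = k y"
  shows "(\<Sum>x\<in>A. w x * (cexp w A k' f x - cexp w A k f x)\<^sup>2)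
       = (\<Sum>x\<in>A. w x * (cexp w A k' f x)\<^sup>2) - (\<Sum>x\<in>A. w x * (cexp w A k f x)\<^sup>2)"
proof -
  let ?q = "cexp w A k f" and ?q' = "cexp w A k' f"
  have q: "k' x = k' y \<Longrightarrow> ?q x = ?q y" for x y
    using kk by (intro cexp_cong_key)
  have "(\<Sum>x\<in>A. w x * (?q x * ?q' x)) = (\<Sum>x\<in>A. w x * (?q x * f x))"
    by (rule cexp_tower[OF A]) (auto dest: q)
  also have "\<dots> = (\<Sum>x\<in>A. w x * (?q x * ?q x))"
    by (rule cexp_tower[OF A, symmetric]) (auto intro: cexp_cong_key)
  finally have *: "(\<Sum>x\<in>A. w x * (?q x * ?q' x)) = (\<Sum>x\<in>A. w x * (?q x * ?q x))" .
  have "(\<Sum>x\<in>A. w x * (?q' x - ?q x)\<^sup>2)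
     = (\<Sum>x\<in>A. w x * (?q' x)\<^sup>2 - 2 * (w x * (?q x * ?q' x)) + w x * (?q x * ?q x))"
    by (intro sum.cong refl) (simp add: power2_eq_square algebra_simps)
  also have "\<dots> = (\<Sum>x\<in>A. w x * (?q' x)\<^sup>2) - 2 * (\<Sum>x\<in>A. w x * (?q x * ?q' x))
      + (\<Sum>x\<in>A. w x * (?q x * ?q x))"
    by (simp add: sum.distrib sum_subtractf sum_distrib_left)
  finally show ?thesis
    by (simp add: * power2_eq_square)
qed

text \<open>A factor \<open>g\<close> known at the finer level sees only the finer estimate of
  \<open>f\<close>. Passing to the coarser one changes the mean by the pairing of \<open>g\<close>
  with the increment, and Cauchy-Schwarz leaves the L2 norm of the increment.\<close>

lemma cexp_replace:
  assumes A: "finite A" "\<And>x. x \<in> A \<Longrightarrow> 0 < w x" "(\<Sum>x\<in>A. w x) = 1"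
    and kk: "\<And>x y. k' x = k' y \<Longrightarrow> k x = k y"
    and g: "\<And>x y. x \<in> A \<Longrightarrow> y \<in> A \<Longrightarrow> k' x = k' y \<Longrightarrow> g x = g y"
    and g01: "\<And>x. x \<in> A \<Longrightarrow> \<bar>g x\<bar> \<le> 1"
  shows "(\<Sum>x\<in>A. w x * (g x * f x)) \<le> (\<Sum>x\<in>A. w x * (g x * cexp w A k f x))
     + sqrt ((\<Sum>x\<in>A. w x * (cexp w A k' f x)\<^sup>2) - (\<Sum>x\<in>A. w x * (cexp w A k f x)\<^sup>2))"
proof -
  let ?q = "cexp w A k f" and ?q' = "cexp w A k' f"
  have "(\<Sum>x\<in>A. w x * (g x * f x)) - (\<Sum>x\<in>A. w x * (g x * ?q x))
     = (\<Sum>x\<in>A. w x * (g x * ?q' x)) - (\<Sum>x\<in>A. w x * (g x * ?q x))"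
    by (subst cexp_tower[OF A(1,2) g]) auto
  also have "\<dots> = (\<Sum>x\<in>A. sqrt (w x) * g x * (sqrt (w x) * (?q' x - ?q x)))"
    unfolding sum_subtractf[symmetric]
  proof (intro sum.cong refl)
    fix x assume "x \<in> A"
    hence "w x = sqrt (w x) * sqrt (w x)" using A(2)[of x] by simp
    thus "w x * (g x * ?q' x) - w x * (g x * ?q x)
        = sqrt (w x) * g x * (sqrt (w x) * (?q' x - ?q x))"
      by (metis (no_types, opaque_lifting) mult.assoc mult.left_commute right_diff_distrib)
  qed
  also have "\<dots> \<le> sqrt ((\<Sum>x\<in>A. (sqrt (w x) * g x)\<^sup>2) * (\<Sum>x\<in>A. (sqrt (w x) * (?q' x - ?q x))\<^sup>2))"
    by (rule real_le_rsqrt[OF Cauchy_Schwarz_ineq_sum])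
  also have "(\<Sum>x\<in>A. (sqrt (w x) * (?q' x - ?q x))\<^sup>2) = (\<Sum>x\<in>A. w x * (?q' x - ?q x)\<^sup>2)"
    using A(2) by (intro sum.cong refl) (simp add: power_mult_distrib less_imp_le)
  also have "(\<Sum>x\<in>A. (sqrt (w x) * g x)\<^sup>2) \<le> (\<Sum>x\<in>A. w x)"
  proof (intro sum_mono)
    fix x assume x: "x \<in> A"
    have "(g x)\<^sup>2 \<le> 1" using g01[OF x] by (simp add: abs_square_le_1)
    thus "(sqrt (w x) * g x)\<^sup>2 \<le> w x"
      using A(2)[OF x] by (simp add: power_mult_distrib mult_left_le)
  qed
  hence "sqrt ((\<Sum>x\<in>A. (sqrt (w x) * g x)\<^sup>2) * (\<Sum>x\<in>A. w x * (?q' x - ?q x)\<^sup>2))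
     \<le> sqrt (\<Sum>x\<in>A. w x * (?q' x - ?q x)\<^sup>2)"
    using A by (intro real_sqrt_le_mono mult_left_le_one_le sum_nonneg) (auto simp: less_imp_le)
  finally show ?thesis
    by (simp add: cexp_increment[where k' = k' and k = k, OF A(1,2) kk])
qed

subsection \<open>The entropy bound\<close>

definition bweight :: "real \<Rightarrow> 'e set \<Rightarrow> 'e set \<Rightarrow> real" where
  "bweight p V x = (\<Prod>e\<in>V. if e \<in> x then p else 1 - p)"

text \<open>The weights describe a random set built rank by rank. No factor reacts to the presence
  of an element \<open>e\<close> of highest rank, so the two choices for \<open>e\<close> contribute
  \<open>q e x\<close> and \<open>1 - q e x\<close>, and \<open>e\<close> can be summed out.\<close>

lemma sum_sequential_weights:
  fixes V :: "'e set" and rank :: "'e \<Rightarrow> nat" and q :: "'e \<Rightarrow> 'e set \<Rightarrow> real"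
  assumes "finite V"
    and "\<And>e x. e \<in> V \<Longrightarrow> q e x = q e (x \<inter> {d. rank d < rank e})"
  shows "(\<Sum>x\<in>Pow V. \<Prod>e\<in>V. if e \<in> x then q e x else 1 - q e x) = 1"
  using assms
proof (induction V rule: finite_ranking_induct[where f = rank])
  case empty
  show ?case by simp
next
  case (insert e S)
  show ?case
  proof (cases "e \<in> S")
    case True
    hence *: "insert e S = S" by (rule insert_absorb)
    show ?thesis unfolding * using insert.IH insert.prems unfolding * by blast
  next
    case False
    have q: "q d (insert e x) = q d x" if "d \<in> insert e S" for d x
    proof -
      have "rank d \<le> rank e" using that insert.hyps by auto
      hence "insert e x \<inter> {c. rank c < rank d} = x \<inter> {c. rank c < rank d}" by auto
      thus ?thesis using insert.prems[OF that] by metis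
    qed
    have eq: "(\<Prod>d\<in>S. if d \<in> insert e x then q d (insert e x) else 1 - q d (insert e x))
        = (\<Prod>d\<in>S. if d \<in> x then q d x else 1 - q d x)" for x
      using False by (intro prod.cong refl) (auto simp: q)
    have inj: "inj_on (insert e) (Pow S)"
      using False by (intro inj_onI) (metis PowD insert_ident subsetD)
    have "(\<Sum>x\<in>Pow (insert e S). \<Prod>d\<in>insert e S. if d \<in> x then q d x else 1 - q d x)
      = (\<Sum>x\<in>Pow S. \<Prod>d\<in>insert e S. if d \<in> x then q d x else 1 - q d x)
      + (\<Sum>x\<in>Pow S. \<Prod>d\<in>insert e S. if d \<in> insert e x then q d (insert e x) else 1 - q d (insert e x))"
      unfolding Pow_insert using False insert.hyps(1)
      by (subst sum.union_disjoint) (auto simp: sum.reindex[OF inj])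
    also have "\<dots> = (\<Sum>x\<in>Pow S. \<Prod>d\<in>S. if d \<in> x then q d x else 1 - q d x)"
      unfolding sum.distrib[symmetric]
    proof (intro sum.cong refl)
      fix x assume "x \<in> Pow S"
      hence "e \<notin> x" using False by auto
      thus "(\<Prod>d\<in>insert e S. if d \<in> x then q d x else 1 - q d x)
          + (\<Prod>d\<in>insert e S. if d \<in> insert e x then q d (insert e x) else 1 - q d (insert e x))
          = (\<Prod>d\<in>S. if d \<in> x then q d x else 1 - q d x)"
        using False insert.hyps(1)
        by (simp only: prod.insert eq not_False_eq_True) (simp add: q algebra_simps)
    qed
    also have "\<dots> = 1" using insert.IH insert.prems by blast
    finally show ?thesis .
  qed
qed

lemma rel_ent_eq:
  "rel_ent r s = r * ln (r / s) + (1 - r) * ln ((1 - r) / (1 - s))"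
  by (simp add: rel_ent_def)

lemma bweight_pos: "0 < p \<Longrightarrow> p < 1 \<Longrightarrow> 0 < bweight p V x"
  unfolding bweight_def by (intro prod_pos) auto

text \<open>Gibbs' inequality against the product of one-step conditional laws. Since each conditional
  probability only sees elements of smaller rank, no conditioning within a rank is needed.\<close>

lemma entropy_bound:
  fixes V :: "'e set" and rank :: "'e \<Rightarrow> nat"
  assumes V: "finite V" and A: "A \<subseteq> Pow V" "A \<noteq> {}" and p: "0 < p" "p < 1"
    and Z: "Z = (\<Sum>x\<in>A. bweight p V x)" and w: "w = (\<lambda>x. bweight p V x / Z)"
    and Q: "Q = (\<lambda>e. cexp w A (\<lambda>x. x \<inter> {d. rank d < rank e}) (\<lambda>x. of_bool (e \<in> x)))"
  shows "ln Z \<le> - (\<Sum>e\<in>V. \<Sum>x\<in>A. w x * rel_ent (Q e x) p)"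
proof -
  have fA: "finite A" using V A finite_subset by blast
  have Zpos: "Z > 0" unfolding Z using fA A p by (intro sum_pos bweight_pos) auto
  have wpos: "w x > 0" for x using Zpos p by (simp add: w bweight_pos)
  have w1: "(\<Sum>x\<in>A. w x) = 1"
    using Zpos by (simp add: w sum_divide_distrib[symmetric] Z[symmetric])
  \<comment> \<open>Given the lower ranks, \<open>\<nu>\<close> makes the elements of one rank
    independent. It is a probability law on \<open>Pow V\<close> that may charge sets outside
    \<open>A\<close>, so its mass on \<open>A\<close> is only bounded by 1.\<close>
  define \<nu> where "\<nu> x = (\<Prod>e\<in>V. if e \<in> x then Q e x else 1 - Q e x)" for x
  have Qbd: "0 \<le> Q e x" "Q e x \<le> 1" for e x
    unfolding Q by (rule cexp_bounds[OF fA wpos]; simp)+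
  have Qpos: "0 < (if e \<in> x then Q e x else 1 - Q e x)" if "x \<in> A" for e x
  proof (cases "e \<in> x")
    case True
    thus ?thesis using that unfolding Q by (auto intro!: cexp_pos[OF fA wpos])
  next
    case False
    have "0 < cexp w A (\<lambda>x. x \<inter> {d. rank d < rank e}) (\<lambda>x. 1 - of_bool (e \<in> x)) x"
      using that False by (intro cexp_pos[OF fA wpos]) auto
    thus ?thesis using False that
      by (simp add: cexp_one_minus[OF fA wpos] Q)
  qed
  have \<nu>pos: "\<nu> x > 0" if "x \<in> A" for x
    unfolding \<nu>_def using Qpos[OF that] by (intro prod_pos) auto
  have "(\<Sum>x\<in>A. \<nu> x) \<le> (\<Sum>x\<in>Pow V. \<nu> x)"
    unfolding \<nu>_def using A V Qbd by (intro sum_mono2 prod_nonneg) (simp_all add: \<nu>_def)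
  also have "\<dots> = 1"
    unfolding \<nu>_def
    by (rule sum_sequential_weights[where rank = rank, OF V]) (auto simp: Q intro!: cexp_cong_key)
  finally have \<nu>1: "(\<Sum>x\<in>A. \<nu> x) \<le> 1" .
  have ln_ratio: "ln (\<nu> x / bweight p V x)
      = (\<Sum>e\<in>V. of_bool (e \<in> x) * ln (Q e x / p) + (1 - of_bool (e \<in> x)) * ln ((1 - Q e x) / (1 - p)))"
    if "x \<in> A" for x
  proof -
    have "\<nu> x / bweight p V x
        = (\<Prod>e\<in>V. (if e \<in> x then Q e x else 1 - Q e x) / (if e \<in> x then p else 1 - p))"
      by (simp add: \<nu>_def bweight_def prod_dividef)
    also have "ln \<dots> = (\<Sum>e\<in>V. ln ((if e \<in> x then Q e x else 1 - Q e x) / (if e \<in> x then p else 1 - p)))"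
      using p Qpos[OF that] by (intro ln_prod V) (metis divide_pos_pos diff_gt_0_iff_gt less_irrefl)
    also have "\<dots> = (\<Sum>e\<in>V. of_bool (e \<in> x) * ln (Q e x / p)
        + (1 - of_bool (e \<in> x)) * ln ((1 - Q e x) / (1 - p)))"
      by (intro sum.cong refl) auto
    finally show ?thesis .
  qed
  \<comment> \<open>The logarithms depend on \<open>x\<close> only through \<open>Q e x\<close>,
    which is constant on the fibres, so the tower property trades the indicator of \<open>e\<close>
    for its conditional mean.\<close>
  have term_eq: "(\<Sum>x\<in>A. w x * (of_bool (e \<in> x) * ln (Q e x / p)
        + (1 - of_bool (e \<in> x)) * ln ((1 - Q e x) / (1 - p))))
      = (\<Sum>x\<in>A. w x * rel_ent (Q e x) p)" for e
  proof -
    have *: "(\<Sum>x\<in>A. w x * (g (Q e x) * Q e x)) = (\<Sum>x\<in>A. w x * (g (Q e x) * of_bool (e \<in> x)))" for g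
      unfolding Q by (rule cexp_tower[OF fA wpos]) (auto intro!: arg_cong[where f = g] cexp_cong_key)
    let ?a = "\<lambda>t. ln (t / p)" and ?b = "\<lambda>t. ln ((1 - t) / (1 - p))"
    have "(\<Sum>x\<in>A. w x * rel_ent (Q e x) p)
      = (\<Sum>x\<in>A. w x * ((?a (Q e x) - ?b (Q e x)) * Q e x)) + (\<Sum>x\<in>A. w x * ?b (Q e x))"
      unfolding sum.distrib[symmetric]
      by (intro sum.cong refl) (simp add: rel_ent_eq algebra_simps)
    also have "\<dots> = (\<Sum>x\<in>A. w x * ((?a (Q e x) - ?b (Q e x)) * of_bool (e \<in> x))) + (\<Sum>x\<in>A. w x * ?b (Q e x))"
      using *[of "\<lambda>t. ?a t - ?b t"] by simp
    also have "\<dots> = (\<Sum>x\<in>A. w x * (of_bool (e \<in> x) * ?a (Q e x) + (1 - of_bool (e \<in> x)) * ?b (Q e x)))"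
      unfolding sum.distrib[symmetric]
      by (intro sum.cong refl) (simp add: algebra_simps)
    finally show ?thesis ..
  qed
  have "(\<Sum>e\<in>V. \<Sum>x\<in>A. w x * rel_ent (Q e x) p) = (\<Sum>x\<in>A. w x * ln (\<nu> x / bweight p V x))"
    unfolding term_eq[symmetric] by (subst sum.swap) (simp add: ln_ratio sum_distrib_left)
  also have "\<dots> = (\<Sum>x\<in>A. w x * (ln (\<nu> x / w x) - ln Z))"
  proof (intro sum.cong refl arg_cong2[where f = "(*)"])
    fix x assume x: "x \<in> A"
    have "\<nu> x / w x / Z = \<nu> x / bweight p V x" using Zpos by (simp add: w divide_simps)
    moreover have "ln (\<nu> x / w x / Z) = ln (\<nu> x / w x) - ln Z"
      using \<nu>pos[OF x] wpos[of x] Zpos by (subst ln_div) simp_all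
    ultimately show "ln (\<nu> x / bweight p V x) = ln (\<nu> x / w x) - ln Z" by metis
  qed
  \<comment> \<open>By \<open>ln y \<le> y - 1\<close> the relative entropy of \<open>w\<close> to
    \<open>\<nu>\<close> is bounded below by the difference of their masses, which is
    non-negative.\<close>
  also have "\<dots> \<le> (\<Sum>x\<in>A. w x * ((\<nu> x / w x - 1) - ln Z))"
    using \<nu>pos wpos by (intro sum_mono mult_left_mono diff_right_mono ln_le_minus_one)
      (auto simp: less_imp_le)
  also have "\<dots> = (\<Sum>x\<in>A. \<nu> x - w x - w x * ln Z)"
    using wpos by (intro sum.cong refl) (simp add: algebra_simps less_imp_neq[THEN not_sym])
  also have "\<dots> = (\<Sum>x\<in>A. \<nu> x) - 1 - ln Z"
    by (simp add: sum_subtractf w1 sum_distrib_right[symmetric])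
  finally show ?thesis using \<nu>1 by simp
qed

section \<open>Vertex permutations acting on edges and triangles\<close>

lemma permutes_transitive_on_subsets:
  assumes S: "finite S" and U: "U \<subseteq> S" "U' \<subseteq> S" and card: "card U = card U'"
  obtains \<pi> where "\<pi> permutes S" "\<pi> ` U = U'"
proof -
  have fin: "finite U" "finite U'" using S U finite_subset by blast+
  obtain f where f: "bij_betw f U U'" using finite_same_card_bij[OF fin card] ..
  have "card (S - U) = card (S - U')" using S U fin card by (simp add: card_Diff_subset)
  then obtain g where g: "bij_betw g (S - U) (S - U')"
    using finite_same_card_bij[of "S - U" "S - U'"] S by auto
  define h where "h x = (if x \<in> U then f x else if x \<in> S then g x else x)" for x
  have hU: "bij_betw h U U'"
    using f by (rule bij_betw_cong[THEN iffD1, rotated]) (simp add: h_def)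
  have "bij_betw h (S - U) (S - U')"
    using g by (rule bij_betw_cong[THEN iffD1, rotated]) (simp add: h_def)
  with hU have "bij_betw h (U \<union> (S - U)) (U' \<union> (S - U'))"
    by (rule bij_betw_combine) auto
  hence "bij_betw h S S" using U by (simp add: Un_absorb1)
  hence "h permutes S" by (rule bij_imp_permutes) (use U in \<open>auto simp: h_def\<close>)
  moreover have "h ` U = U'" using hU by (simp add: bij_betw_def)
  ultimately show ?thesis by (rule that)
qed

definition pairs :: "nat set \<Rightarrow> nat set set" where
  "pairs U = {e. e \<subseteq> U \<and> card e = 2}"

definition triples :: "nat \<Rightarrow> nat set set" where
  "triples n = {U. U \<subseteq> {1..n} \<and> card U = 3}"

text \<open>Counting unordered triples lets a vertex permutation act by taking images. The ordered
  count of \<open>num_triangles\<close> is recovered in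
  \<open>num_triangles_eq_tri_count\<close>.\<close>

definition tri_count :: "nat \<Rightarrow> nat set set \<Rightarrow> nat" where
  "tri_count n x = card {U \<in> triples n. pairs U \<subseteq> x}"

lemma finite_vertex_pairs [simp]: "finite (vertex_pairs n)"
  by (rule finite_subset[of _ "Pow {1..n}"]) (auto simp: vertex_pairs_def)

lemma finite_triples [simp]: "finite (triples n)"
  by (rule finite_subset[of _ "Pow {1..n}"]) (auto simp: triples_def)

lemma card_vertex_pairs: "card (vertex_pairs n) = n choose 2"
  by (simp add: vertex_pairs_def n_subsets)

lemma card_triples: "card (triples n) = n choose 3"
  by (simp add: triples_def n_subsets)

lemma tri_count_eq_sum: "real (tri_count n x) = (\<Sum>U\<in>triples n. of_bool (pairs U \<subseteq> x))"
proof -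
  have "(\<Sum>U\<in>triples n. of_bool (pairs U \<subseteq> x) :: real) = (\<Sum>U\<in>triples n. if pairs U \<subseteq> x then 1 else 0)"
    by (intro sum.cong refl) auto
  also have "\<dots> = (\<Sum>U\<in>{U \<in> triples n. pairs U \<subseteq> x}. 1)"
    by (rule sum.inter_filter[symmetric]) simp
  finally show ?thesis by (simp add: tri_count_def)
qed

lemma pairs_image: "inj \<pi> \<Longrightarrow> pairs (\<pi> ` U) = (`) \<pi> ` pairs U"
proof (intro set_eqI iffI)
  fix e assume \<pi>: "inj \<pi>" and "e \<in> pairs (\<pi> ` U)"
  hence e: "e \<subseteq> \<pi> ` U" "card e = 2" by (auto simp: pairs_def)
  then obtain d where "d \<subseteq> U" "e = \<pi> ` d" using subset_image_iff by metis
  thus "e \<in> (`) \<pi> ` pairs U"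
    using e \<pi> by (auto simp: pairs_def card_image inj_on_subset[of \<pi> UNIV])
qed (auto simp: pairs_def card_image inj_on_subset[of \<pi> UNIV])

lemma pairs_triple:
  assumes "a \<noteq> b" "a \<noteq> c" "b \<noteq> c"
  shows "pairs {a, b, c} = {{a, b}, {a, c}, {b, c}}"
proof (intro set_eqI iffI)
  fix e assume "e \<in> pairs {a, b, c}"
  then obtain u v where "e = {u, v}" "u \<noteq> v" "{u, v} \<subseteq> {a, b, c}"
    by (auto simp: pairs_def card_2_iff)
  thus "e \<in> {{a, b}, {a, c}, {b, c}}" by auto
qed (use assms in \<open>auto simp: pairs_def\<close>)

lemma vertex_pairs_Min: "e \<in> vertex_pairs n \<Longrightarrow> finite e \<and> e \<noteq> {} \<and> Min e \<in> {1..n}"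
proof -
  assume e: "e \<in> vertex_pairs n"
  hence *: "finite e" "e \<noteq> {}" by (auto simp: vertex_pairs_def intro: card_ge_0_finite)
  moreover have "Min e \<in> {1..n}" using e Min_in[OF *] by (auto simp: vertex_pairs_def)
  ultimately show ?thesis by blast
qed

lemma image_in_vertex_pairs:
  assumes "\<pi> permutes {1..n}"
  shows "\<pi> ` e \<in> vertex_pairs n \<longleftrightarrow> e \<in> vertex_pairs n"
proof -
  have "card (\<pi> ` e) = card e" using permutes_inj[OF assms] by (auto intro: card_image inj_on_subset)
  moreover have "\<pi> ` e \<subseteq> {1..n} \<longleftrightarrow> e \<subseteq> {1..n}"
    using permutes_in_image[OF assms] by blast
  ultimately show ?thesis by (simp add: vertex_pairs_def)
qed

lemma bij_betw_vertex_pairs: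
  assumes "\<pi> permutes {1..n}"
  shows "bij_betw ((`) \<pi>) (vertex_pairs n) (vertex_pairs n)"
proof (rule bij_betw_byWitness[where f' = "(`) (inv \<pi>)"])
  show "(`) (inv \<pi>) ` vertex_pairs n \<subseteq> vertex_pairs n"
    using image_in_vertex_pairs[OF permutes_inv[OF assms]] by blast
qed (use image_in_vertex_pairs[OF assms] permutes_inverses[OF assms] in \<open>auto simp: image_image\<close>)

text \<open>Edge sets are acted on by vertex permutations through \<open>x \<mapsto> (`) \<pi> ` x\<close>.\<close>

lemma image_act_mem: "inj \<pi> \<Longrightarrow> \<pi> ` e \<in> (`) \<pi> ` x \<longleftrightarrow> e \<in> x"
  by (auto simp: inj_image_eq_iff)

lemma image_act_subset: "inj \<pi> \<Longrightarrow> (`) \<pi> ` y \<subseteq> (`) \<pi> ` x \<longleftrightarrow> y \<subseteq> x"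
  by (auto simp: inj_image_eq_iff image_subset_iff)

lemma tri_count_act:
  assumes "\<pi> permutes {1..n}"
  shows "tri_count n ((`) \<pi> ` x) = tri_count n x"
proof -
  have inj: "inj \<pi>" using assms by (rule permutes_inj)

  have mem: "\<pi> ` U \<in> {U \<in> triples n. pairs U \<subseteq> (`) \<pi> ` x} \<longleftrightarrow> U \<in> {U \<in> triples n. pairs U \<subseteq> x}" for U
  proof -
    have "card (\<pi> ` U) = card U" using inj by (auto intro: card_image inj_on_subset)
    moreover have "\<pi> ` U \<subseteq> {1..n} \<longleftrightarrow> U \<subseteq> {1..n}"
      using permutes_in_image[OF assms] by blast
    ultimately show ?thesis by (simp add: triples_def pairs_image[OF inj] image_act_subset[OF inj])
  qed
  have "bij_betw ((`) \<pi>) {U \<in> triples n. pairs U \<subseteq> x} {U \<in> triples n. pairs U \<subseteq> (`) \<pi> ` x}"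
  proof (rule bij_betw_byWitness[where f' = "(`) (inv \<pi>)"])
    show "(`) (inv \<pi>) ` {U \<in> triples n. pairs U \<subseteq> (`) \<pi> ` x} \<subseteq> {U \<in> triples n. pairs U \<subseteq> x}"
    proof (rule image_subsetI)
      fix U assume "U \<in> {U \<in> triples n. pairs U \<subseteq> (`) \<pi> ` x}"
      hence "\<pi> ` inv \<pi> ` U \<in> {U \<in> triples n. pairs U \<subseteq> (`) \<pi> ` x}"
        by (simp add: image_image permutes_inverses[OF assms])
      thus "inv \<pi> ` U \<in> {U \<in> triples n. pairs U \<subseteq> x}" by (rule mem[THEN iffD1])
    qed
    show "(`) \<pi> ` {U \<in> triples n. pairs U \<subseteq> x} \<subseteq> {U \<in> triples n. pairs U \<subseteq> (`) \<pi> ` x}"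
      by (rule image_subsetI) (rule mem[THEN iffD2])
  qed (simp_all add: image_image permutes_inverses[OF assms])
  from bij_betw_same_card[OF this] show ?thesis by (simp add: tri_count_def)
qed

subsection \<open>Symmetric events\<close>

text \<open>The weights \<open>w\<close> are the law of the random graph conditioned on
  \<open>A\<close>, and \<open>Z\<close> is the probability of \<open>A\<close>. Invariance of
  \<open>A\<close> under relabelling makes this law exchangeable; both the tail event and the window
  event have this form.\<close>

locale symmetric_event =
  fixes n :: nat and p :: real and A :: "nat set set set"
  assumes p: "0 < p" "p < 1"
    and sub: "A \<subseteq> Pow (vertex_pairs n)" and ne: "A \<noteq> {}"
    and sym: "\<And>\<pi> x. \<pi> permutes {1..n} \<Longrightarrow> x \<in> A \<Longrightarrow> (`) \<pi> ` x \<in> A"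
begin

definition Z :: real where "Z = (\<Sum>x\<in>A. bweight p (vertex_pairs n) x)"

definition w :: "nat set set \<Rightarrow> real" where "w x = bweight p (vertex_pairs n) x / Z"

definition ev :: "(nat set set \<Rightarrow> real) \<Rightarrow> real" where "ev f = (\<Sum>x\<in>A. w x * f x)"

text \<open>The time \<open>m\<close> is a parameter of its own, not \<open>Min e\<close>, so that
  all pairs inside \<open>{m..n}\<close> can be compared under the same information and one fixed
  edge can be followed as \<open>m\<close> grows.\<close>

definition Q :: "nat \<Rightarrow> nat set \<Rightarrow> nat set set \<Rightarrow> real" where
  "Q m e = cexp w A (\<lambda>x. x \<inter> {d. Min d < m}) (\<lambda>x. of_bool (e \<in> x))"

lemma finite_A: "finite A"
  using sub by (rule finite_subset) simp

lemma Z_pos: "Z > 0"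
  unfolding Z_def using finite_A ne p by (intro sum_pos bweight_pos)

lemma w_pos: "w x > 0"
  using Z_pos p by (simp add: w_def bweight_pos)

lemma w_sum: "(\<Sum>x\<in>A. w x) = 1"
  using Z_pos by (simp add: w_def sum_divide_distrib[symmetric] Z_def[symmetric])

lemma ev_mono: "(\<And>x. x \<in> A \<Longrightarrow> f x \<le> g x) \<Longrightarrow> ev f \<le> ev g"
  unfolding ev_def by (intro sum_mono mult_left_mono less_imp_le[OF w_pos])

lemma ev_add: "ev (\<lambda>x. f x + g x) = ev f + ev g"
  by (simp add: ev_def sum.distrib distrib_left)

lemma ev_cmult: "ev (\<lambda>x. c * f x) = c * ev f"
  by (simp add: ev_def sum_distrib_left mult_ac)

lemma ev_const: "ev (\<lambda>x. c) = c"
  by (simp add: ev_def sum_distrib_right[symmetric] w_sum)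

lemma ev_sum: "ev (\<lambda>x. \<Sum>i\<in>I. f i x) = (\<Sum>i\<in>I. ev (f i))"
  unfolding ev_def sum_distrib_left by (rule sum.swap)

lemma ev_cong: "(\<And>x. x \<in> A \<Longrightarrow> f x = g x) \<Longrightarrow> ev f = ev g"
  by (simp add: ev_def)

lemma act_inv:
  assumes "\<pi> permutes {1..n}"
  shows "(`) (inv \<pi>) ` (`) \<pi> ` x = x" "(`) \<pi> ` (`) (inv \<pi>) ` x = x"
  using permutes_inverses[OF assms] by (simp_all add: image_image)

lemma w_act:
  assumes "\<pi> permutes {1..n}"
  shows "w ((`) \<pi> ` x) = w x"
proof -
  have inj: "inj \<pi>" using assms by (rule permutes_inj)
  have "bweight p (vertex_pairs n) ((`) \<pi> ` x)
      = (\<Prod>e\<in>vertex_pairs n. if \<pi> ` e \<in> (`) \<pi> ` x then p else 1 - p)"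
    unfolding bweight_def
    by (rule prod.reindex_bij_betw[OF bij_betw_vertex_pairs[OF assms], symmetric])
  also have "\<dots> = bweight p (vertex_pairs n) x"
    by (simp only: image_act_mem[OF inj] bweight_def)
  finally have "bweight p (vertex_pairs n) ((`) \<pi> ` x) = bweight p (vertex_pairs n) x" .
  thus ?thesis by (simp add: w_def)
qed

lemma ev_act:
  assumes "\<pi> permutes {1..n}"
  shows "ev (\<lambda>x. f ((`) \<pi> ` x)) = ev f"
  unfolding ev_def
  by (rule sum.reindex_bij_witness[where i = "\<lambda>x. (`) (inv \<pi>) ` x" and j = "\<lambda>x. (`) \<pi> ` x"])
    (use assms in \<open>simp_all add: act_inv w_act sym permutes_inv\<close>)

text \<open>A permutation of \<open>{m..n}\<close> fixes every vertex below \<open>m\<close> and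
  keeps the others at \<open>m\<close> or above, so it carries the revealed edges of
  \<open>x\<close> to the revealed edges of its image.\<close>

lemma key_act:
  assumes \<pi>: "\<pi> permutes {m..n}" "1 \<le> m" and x: "x \<in> A"
  shows "(`) \<pi> ` x \<inter> {d. Min d < m} = (`) \<pi> ` (x \<inter> {d. Min d < m})"
proof -
  have \<pi>1: "\<pi> permutes {1..n}" by (rule permutes_subset[OF \<pi>(1)]) (use \<pi>(2) in auto)
  have "Min (\<pi> ` d) < m \<longleftrightarrow> Min d < m" if "d \<in> x" for d
  proof -
    have dV: "d \<in> vertex_pairs n" using that x sub by blast
    have d: "finite d" "d \<noteq> {}" "d \<subseteq> {1..n}"
      using vertex_pairs_Min[OF dV] dV unfolding vertex_pairs_def by blast+
    have *: "\<pi> a < m \<longleftrightarrow> a < m" if "a \<in> d" for a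
      using permutes_in_image[OF \<pi>(1), of a] permutes_in_image[OF \<pi>1, of a] that d(3) by auto
    show ?thesis using d * by (auto simp: Min_less_iff)
  qed
  thus ?thesis by auto
qed

text \<open>The permutation maps the fibre of \<open>x\<close> onto the fibre of its image and
  preserves weights, so both sums in the quotient can be reindexed.\<close>

lemma Q_act:
  assumes \<pi>: "\<pi> permutes {m..n}" "1 \<le> m" and x: "x \<in> A"
  shows "Q m (\<pi> ` e) ((`) \<pi> ` x) = Q m e x"
proof -
  have \<pi>1: "\<pi> permutes {1..n}" by (rule permutes_subset[OF \<pi>(1)]) (use \<pi>(2) in auto)
  have inj: "inj \<pi>" using \<pi>1 by (rule permutes_inj)
  define K where "K y = y \<inter> {d. Min d < m}" for y :: "nat set set"
  have K: "K ((`) \<pi> ` y) = K ((`) \<pi> ` x) \<longleftrightarrow> K y = K x" if "y \<in> A" for y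
  proof -
    have "inj ((`) \<pi>)" using inj by (auto simp: inj_on_def inj_image_eq_iff)
    thus ?thesis
      unfolding K_def key_act[OF \<pi> that] key_act[OF \<pi> x] by (rule inj_image_eq_iff)
  qed
  have inA: "(`) \<pi> ` y \<in> A" "(`) (inv \<pi>) ` y \<in> A" if "y \<in> A" for y
    using sym \<pi>1 that permutes_inv by blast+
  have *: "(\<Sum>y\<in>{y\<in>A. K y = K ((`) \<pi> ` x)}. h y) = (\<Sum>y\<in>{y\<in>A. K y = K x}. h ((`) \<pi> ` y))"
    for h :: "nat set set \<Rightarrow> real"
  proof (rule sum.reindex_bij_witness[where j = "\<lambda>x. (`) (inv \<pi>) ` x" and i = "\<lambda>x. (`) \<pi> ` x"])
    fix y assume "y \<in> {y\<in>A. K y = K ((`) \<pi> ` x)}"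
    thus "(`) (inv \<pi>) ` y \<in> {y\<in>A. K y = K x}"
      using inA K[of "(`) (inv \<pi>) ` y"] by (simp add: act_inv[OF \<pi>1])
  qed (use inA K in \<open>simp_all add: act_inv[OF \<pi>1]\<close>)
  show ?thesis
    unfolding Q_def cexp_def K_def[symmetric] * w_act[OF \<pi>1] image_act_mem[OF inj] ..
qed

lemma Q_bounds: "0 \<le> Q m e x" "Q m e x \<le> 1"
  unfolding Q_def by (rule cexp_bounds[OF finite_A w_pos]; simp)+

lemma Q_cube_exchange:
  assumes m: "1 \<le> m" and e: "e \<subseteq> {m..n}" "e' \<subseteq> {m..n}" "card e = card e'"
  shows "ev (\<lambda>x. Q m e x ^ 3) = ev (\<lambda>x. Q m e' x ^ 3)"
proof -
  obtain \<pi> where \<pi>: "\<pi> permutes {m..n}" "\<pi> ` e = e'"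
    by (rule permutes_transitive_on_subsets[OF finite_atLeastAtMost e])
  have \<pi>1: "\<pi> permutes {1..n}" by (rule permutes_subset[OF \<pi>(1)]) (use m in auto)
  have "ev (\<lambda>x. Q m e' x ^ 3) = ev (\<lambda>x. Q m e' ((`) \<pi> ` x) ^ 3)"
    by (rule ev_act[OF \<pi>1, symmetric])
  also have "\<dots> = ev (\<lambda>x. Q m e x ^ 3)"
    using Q_act[OF \<pi>(1) m, of _ e] \<pi>(2) by (intro ev_cong) simp
  finally show ?thesis ..
qed

text \<open>Exchangeability makes every triple equally likely to be a triangle. A lower bound on the
  total count thus becomes one for any chosen triple, later \<open>{m, n - 1, n}\<close>.\<close>

lemma ev_tri_count:
  assumes U: "U \<in> triples n"
  shows "ev (\<lambda>x. real (tri_count n x)) = real (n choose 3) * ev (\<lambda>x. of_bool (pairs U \<subseteq> x))"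
proof -
  have eq: "ev (\<lambda>x. of_bool (pairs U' \<subseteq> x)) = ev (\<lambda>x. of_bool (pairs U \<subseteq> x))" if U': "U' \<in> triples n" for U'
  proof -
    have "U' \<subseteq> {1..n}" "U \<subseteq> {1..n}" "card U' = card U"
      using U U' by (auto simp: triples_def)
    then obtain \<pi> where \<pi>: "\<pi> permutes {1..n}" "\<pi> ` U' = U"
      by (rule permutes_transitive_on_subsets[OF finite_atLeastAtMost])
    have inj: "inj \<pi>" using \<pi>(1) by (rule permutes_inj)
    have "ev (\<lambda>x. of_bool (pairs U \<subseteq> x)) = ev (\<lambda>x. of_bool (pairs (\<pi> ` U') \<subseteq> (`) \<pi> ` x))"
      unfolding \<pi>(2) by (rule ev_act[OF \<pi>(1), symmetric])
    also have "\<dots> = ev (\<lambda>x. of_bool (pairs U' \<subseteq> x))"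
      by (simp add: pairs_image[OF inj] image_act_subset[OF inj])
    finally show ?thesis ..
  qed
  have "ev (\<lambda>x. real (tri_count n x)) = ev (\<lambda>x. \<Sum>U'\<in>triples n. of_bool (pairs U' \<subseteq> x))"
    unfolding tri_count_eq_sum ..
  also have "\<dots> = real (n choose 3) * ev (\<lambda>x. of_bool (pairs U \<subseteq> x))"
    unfolding ev_sum by (simp add: eq card_triples)
  finally show ?thesis .
qed

text \<open>The edge \<open>{n - 1, n}\<close> is revealed last, so it can serve as the reference
  for every \<open>m\<close>. By \<open>cexp_increment\<close> this is the mean squared martingale
  increment; the difference form is the one that telescopes.\<close>

definition increment :: "nat \<Rightarrow> real" where
  "increment m = ev (\<lambda>x. (Q (Suc m) {n - 1, n} x)\<^sup>2) - ev (\<lambda>x. (Q m {n - 1, n} x)\<^sup>2)"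

lemma key_mono: "x \<inter> {d. Min d < Suc m} = y \<inter> {d. Min d < Suc m} \<Longrightarrow>
    x \<inter> {d. Min d < m} = y \<inter> {d. Min d < (m::nat)}"
  by (auto simp: set_eq_iff dest: less_SucI)

lemma increment_nonneg: "0 \<le> increment m"
proof -
  have "increment m = (\<Sum>x\<in>A. w x * (Q (Suc m) {n - 1, n} x - Q m {n - 1, n} x)\<^sup>2)"
    unfolding increment_def ev_def Q_def
    by (rule cexp_increment[OF finite_A w_pos, symmetric]) (auto dest: key_mono)
  thus ?thesis by (auto intro!: sum_nonneg mult_nonneg_nonneg less_imp_le[OF w_pos])
qed

lemma Q_replace:
  assumes "\<And>x y. x \<inter> {d. Min d < Suc m} = y \<inter> {d. Min d < Suc m} \<Longrightarrow> g x = g y"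
    and "\<And>x. \<bar>g x\<bar> \<le> 1"
  shows "ev (\<lambda>x. g x * of_bool ({n - 1, n} \<in> x)) \<le> ev (\<lambda>x. g x * Q m {n - 1, n} x) + sqrt (increment m)"
  unfolding increment_def ev_def Q_def
  by (rule cexp_replace[OF finite_A w_pos w_sum]) (erule key_mono, erule assms(1), rule assms(2))

text \<open>In the triangle on \<open>m\<close>, \<open>n - 1\<close>, \<open>n\<close> only the
  reference edge is still hidden once the edges at \<open>m\<close> are revealed. Its indicator is
  replaced by the conditional probability at time \<open>m\<close>, at the cost of one increment.
  Exchanging \<open>m\<close> and \<open>n - 1\<close> puts the edge \<open>{m, n}\<close> into the
  reference position, and the same replacement applies again.\<close>

lemma ev_cube_ge:
  assumes m: "1 \<le> m" "m + 2 \<le> n"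
  shows "ev (\<lambda>x. of_bool (pairs {m, n - 1, n} \<subseteq> x)) - 2 * sqrt (increment m)
       \<le> ev (\<lambda>x. Q m {n - 1, n} x ^ 3)"
proof -
  define a where "a = n - 1"
  have amn: "a \<noteq> m" "a \<noteq> n" "m \<noteq> n" "m < a" "m < n" "a \<le> n" using m by (auto simp: a_def)
  let ?X = "\<lambda>e x. of_bool (e \<in> x) :: real"
  have meas: "?X e x = ?X e y"
    if "x \<inter> {d. Min d < Suc m} = y \<inter> {d. Min d < Suc m}" "Min e = m" for e x y
    using that by (auto simp: set_eq_iff)
  have Qmeas: "Q m e x = Q m e y"
    if "x \<inter> {d. Min d < Suc m} = y \<inter> {d. Min d < Suc m}" for e x y
    unfolding Q_def by (rule cexp_cong_key) (rule key_mono[OF that])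
  have Min: "Min {m, a} = m" "Min {m, n} = m" using amn by auto
  define \<pi> where "\<pi> = Transposition.transpose m a"
  have \<pi>m: "\<pi> permutes {m..n}" unfolding \<pi>_def using amn m by (intro permutes_swap_id) (auto simp: a_def)
  have \<pi>1: "\<pi> permutes {1..n}" by (rule permutes_subset[OF \<pi>m]) (use m in auto)
  have inj: "inj \<pi>" using \<pi>1 by (rule permutes_inj)
  have \<pi>_img: "\<pi> ` {m, n} = {a, n}" "\<pi> ` {m, a} = {m, a}" "\<pi> ` {a, n} = {m, n}"
    using amn by (auto simp: \<pi>_def Transposition.transpose_def)
  have swap_mem: "{m, a} \<in> (`) \<pi> ` x \<longleftrightarrow> {m, a} \<in> x" "{m, n} \<in> (`) \<pi> ` x \<longleftrightarrow> {a, n} \<in> x"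
    for x :: "nat set set"
    using image_act_mem[OF inj, of "{m, a}" x] image_act_mem[OF inj, of "{a, n}" x]
    unfolding \<pi>_img by blast+

  have "ev (\<lambda>x. of_bool (pairs {m, a, n} \<subseteq> x)) = ev (\<lambda>x. ?X {m, a} x * ?X {m, n} x * ?X {a, n} x)"
    using amn by (intro ev_cong) (simp add: pairs_triple)
  also have "\<dots> \<le> ev (\<lambda>x. ?X {m, a} x * ?X {m, n} x * Q m {a, n} x) + sqrt (increment m)"
    unfolding a_def
  proof (rule Q_replace)
    fix x y :: "nat set set"
    assume "x \<inter> {d. Min d < Suc m} = y \<inter> {d. Min d < Suc m}"
    from meas[OF this Min(1)] meas[OF this Min(2)]
    show "?X {m, n - 1} x * ?X {m, n} x = ?X {m, n - 1} y * ?X {m, n} y" by (simp only: a_def)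
  qed auto
  also have "ev (\<lambda>x. ?X {m, a} x * ?X {m, n} x * Q m {a, n} x)
      = ev (\<lambda>x. ?X {m, a} ((`) \<pi> ` x) * ?X {m, n} ((`) \<pi> ` x) * Q m {a, n} ((`) \<pi> ` x))"
    by (rule ev_act[OF \<pi>1, symmetric])
  also have "\<dots> = ev (\<lambda>x. ?X {m, a} x * Q m {m, n} x * ?X {a, n} x)"
    using Q_act[OF \<pi>m m(1), of _ "{m, n}"] unfolding \<pi>_img swap_mem
    by (intro ev_cong) simp
  also have "\<dots> \<le> ev (\<lambda>x. ?X {m, a} x * Q m {m, n} x * Q m {a, n} x) + sqrt (increment m)"
    unfolding a_def
  proof (rule Q_replace)
    fix x y :: "nat set set"
    assume "x \<inter> {d. Min d < Suc m} = y \<inter> {d. Min d < Suc m}"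
    from meas[OF this Min(1)] Qmeas[OF this]
    show "?X {m, n - 1} x * Q m {m, n} x = ?X {m, n - 1} y * Q m {m, n} y" by (simp only: a_def)
  qed (auto simp: Q_bounds)
  \<comment> \<open>The third edge costs nothing: both other factors are now known at time
    \<open>m\<close>, so the tower property replaces its indicator exactly.\<close>
  also have "ev (\<lambda>x. ?X {m, a} x * Q m {m, n} x * Q m {a, n} x)
      = ev (\<lambda>x. (Q m {m, n} x * Q m {a, n} x) * ?X {m, a} x)"
    by (simp add: mult_ac)
  also have "\<dots> = ev (\<lambda>x. (Q m {m, n} x * Q m {a, n} x) * Q m {m, a} x)"
    unfolding ev_def Q_def
    by (rule cexp_tower[OF finite_A w_pos, symmetric])
      (intro arg_cong2[where f = "(*)"] cexp_cong_key; assumption)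
  also have "\<dots> \<le> ev (\<lambda>x. 1/3 * (Q m {m, n} x ^ 3 + Q m {a, n} x ^ 3 + Q m {m, a} x ^ 3))"
  proof (rule ev_mono)
    fix x
    have amgm: "u * v * t \<le> 1/3 * (u ^ 3 + v ^ 3 + t ^ 3)" if "0 \<le> u" "0 \<le> v" "0 \<le> t" for u v t :: real
    proof -
      have "0 \<le> (u + v + t) * ((u - v)\<^sup>2 + (v - t)\<^sup>2 + (u - t)\<^sup>2)"
        using that by (intro mult_nonneg_nonneg add_nonneg_nonneg) auto
      also have "\<dots> = 2 * (u ^ 3 + v ^ 3 + t ^ 3 - 3 * (u * v * t))"
        by (simp add: power2_eq_square power3_eq_cube algebra_simps)
      finally show ?thesis by simp
    qed
    show "Q m {m, n} x * Q m {a, n} x * Q m {m, a} x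
        \<le> 1/3 * (Q m {m, n} x ^ 3 + Q m {a, n} x ^ 3 + Q m {m, a} x ^ 3)"
      by (intro amgm Q_bounds)
  qed
  also have "\<dots> = 1/3 * (ev (\<lambda>x. Q m {m, n} x ^ 3) + ev (\<lambda>x. Q m {a, n} x ^ 3) + ev (\<lambda>x. Q m {m, a} x ^ 3))"
    by (simp only: ev_cmult ev_add)
  also have "ev (\<lambda>x. Q m {m, n} x ^ 3) = ev (\<lambda>x. Q m {a, n} x ^ 3)"
    using m amn by (intro Q_cube_exchange) (auto simp: card_insert_if)
  also have "ev (\<lambda>x. Q m {m, a} x ^ 3) = ev (\<lambda>x. Q m {a, n} x ^ 3)"
    using m amn by (intro Q_cube_exchange) (auto simp: card_insert_if a_def)
  finally show ?thesis by (simp add: a_def)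
qed

section \<open>Summing the losses over all edges\<close>

lemma sum_sqrt_increment_le:
  assumes "2 \<le> n"
  shows "(\<Sum>m = 1..<n-1. sqrt (increment m)) \<le> sqrt (real n)"
proof -
  have "(\<Sum>m = 1..<n-1. increment m)
      = ev (\<lambda>x. (Q (n - 1) {n - 1, n} x)\<^sup>2) - ev (\<lambda>x. (Q 1 {n - 1, n} x)\<^sup>2)"
    unfolding increment_def by (rule sum_Suc_diff') (use assms in auto)
  also have "\<dots> \<le> ev (\<lambda>x. 1) - ev (\<lambda>x. 0)"
    by (intro diff_mono ev_mono power_le_one Q_bounds) simp
  finally have *: "(\<Sum>m = 1..<n-1. increment m) \<le> 1" by (simp add: ev_const)
  have "(\<Sum>m = 1..<n-1. sqrt (increment m) * 1)\<^sup>2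
      \<le> (\<Sum>m = 1..<n-1. (sqrt (increment m))\<^sup>2) * (\<Sum>m = 1..<n-1. 1\<^sup>2)"
    by (rule Cauchy_Schwarz_ineq_sum)
  also have "\<dots> = (\<Sum>m = 1..<n-1. increment m) * real (n - 2)"
    by (simp add: increment_nonneg numeral_2_eq_2)
  also have "\<dots> \<le> 1 * real n"
    using * by (intro mult_mono) auto
  finally show ?thesis by (simp add: real_le_rsqrt)
qed

text \<open>At most \<open>n\<close> edges share a given smaller endpoint \<open>i\<close>, since
  the other endpoint determines the edge.\<close>

lemma sum_over_Min_le:
  assumes f: "\<And>i. 0 \<le> f i"
  shows "(\<Sum>e\<in>vertex_pairs n. f (Min e)) \<le> real n * (\<Sum>i = 1..n. f i)"
proof -
  have "(\<Sum>e\<in>vertex_pairs n. f (Min e)) = (\<Sum>i = 1..n. \<Sum>e\<in>{e \<in> vertex_pairs n. Min e = i}. f (Min e))"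
    by (rule sum.group[symmetric, OF _ _ image_subsetI]) (use vertex_pairs_Min in \<open>blast | simp\<close>)+
  also have "\<dots> = (\<Sum>i = 1..n. real (card {e \<in> vertex_pairs n. Min e = i}) * f i)"
    by (intro sum.cong refl) simp
  also have "\<dots> \<le> (\<Sum>i = 1..n. real n * f i)"
  proof (intro sum_mono mult_right_mono f)
    fix i
    have "{e \<in> vertex_pairs n. Min e = i} \<subseteq> (\<lambda>j. {i, j}) ` {1..n}"
    proof
      fix e assume e: "e \<in> {e \<in> vertex_pairs n. Min e = i}"
      hence "i \<in> e" using vertex_pairs_Min[of e n] Min_in by auto
      moreover from e obtain u v where uv: "e = {u, v}" "u \<in> {1..n}" "v \<in> {1..n}"
        by (auto simp: vertex_pairs_def card_2_iff)
      ultimately show "e \<in> (\<lambda>j. {i, j}) ` {1..n}" by auto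
    qed
    from card_mono[OF _ this] have "card {e \<in> vertex_pairs n. Min e = i} \<le> card ((\<lambda>j. {i, j}) ` {1..n})"
      by simp
    also have "\<dots> \<le> n" using card_image_le[of "{1..n}" "\<lambda>j. {i, j}"] by simp
    finally show "real (card {e \<in> vertex_pairs n. Min e = i}) \<le> real n" by simp
  qed
  finally show ?thesis by (simp add: sum_distrib_left)
qed

text \<open>Any line of non-negative slope below the entropy, in the coordinate
  \<open>q ^ 3\<close>, turns a lower bound on the means of \<open>q ^ 3\<close> into one on the
  entropy sum. Here \<open>t\<close> is a lower bound for the triangle density on
  \<open>A\<close>.\<close>

lemma ln_Z_le:
  assumes n: "3 \<le> n" and l: "0 \<le> l" and t: "t \<le> 1"
    and tangent: "\<And>q. 0 \<le> q \<Longrightarrow> q \<le> 1 \<Longrightarrow> c + l * q ^ 3 \<le> rel_ent q p"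
    and tri: "\<And>x. x \<in> A \<Longrightarrow> real (n choose 3) * t \<le> real (tri_count n x)"
  shows "ln Z \<le> - real (n choose 2) * (c + l * t) + l * (real n * (2 + 2 * sqrt (real n)))"
proof -
  have choose_pos: "0 < n choose 3" using n by (simp add: zero_less_binomial_iff)
  \<comment> \<open>For \<open>i > n - 2\<close> there is no triple \<open>{i, n - 1, n}\<close> of
    size 3. The loss 1 is then enough because \<open>t \<le> 1\<close>; the indices
    \<open>n - 1\<close> and \<open>n\<close> account for the summand 2 in the final bound.\<close>
  define f where "f i = (if i + 2 \<le> n then 2 * sqrt (increment i) else 1)" for i
  have f_nonneg: "0 \<le> f i" for i by (simp add: f_def increment_nonneg)
  have cube: "t - f (Min e) \<le> ev (\<lambda>x. Q (Min e) e x ^ 3)" if e: "e \<in> vertex_pairs n" for e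
  proof (cases "Min e + 2 \<le> n")
    case True
    define m where "m = Min e"
    have m: "1 \<le> m" "m + 2 \<le> n" using True vertex_pairs_Min[OF e] by (auto simp: m_def)
    have "{m, n - 1, n} \<in> triples n" using m by (auto simp: triples_def card_insert_if)
    have "ev (\<lambda>x. real (n choose 3) * t) \<le> ev (\<lambda>x. real (tri_count n x))"
      by (rule ev_mono) (rule tri)
    also note ev_tri_count[OF \<open>{m, n - 1, n} \<in> triples n\<close>]
    finally have "real (n choose 3) * t \<le> real (n choose 3) * ev (\<lambda>x. of_bool (pairs {m, n - 1, n} \<subseteq> x))"
      by (simp only: ev_const)
    hence "t \<le> ev (\<lambda>x. of_bool (pairs {m, n - 1, n} \<subseteq> x))"
      using choose_pos by simp
    hence "t - f m \<le> ev (\<lambda>x. Q m {n - 1, n} x ^ 3)"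
      using ev_cube_ge[OF m] m by (simp add: f_def)
    also have "\<dots> = ev (\<lambda>x. Q m e x ^ 3)"
    proof (rule Q_cube_exchange[OF m(1)])
      show "e \<subseteq> {m..n}"
        using vertex_pairs_Min[OF e] e by (auto simp: vertex_pairs_def m_def)
    qed (use m e in \<open>auto simp: vertex_pairs_def card_insert_if\<close>)
    finally show ?thesis by (simp add: m_def)
  next
    case False
    have "0 \<le> ev (\<lambda>x. Q (Min e) e x ^ 3)"
      using ev_mono[of "\<lambda>x. 0"] Q_bounds by (simp add: ev_const)
    thus ?thesis using False t by (simp add: f_def)
  qed
  have "(\<Sum>e\<in>vertex_pairs n. f (Min e)) \<le> real n * (\<Sum>i = 1..n. f i)"
    by (rule sum_over_Min_le) (rule f_nonneg)
  also have "{1..n} = {1..<n-1} \<union> {n - 1, n}" using n by auto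
  also have "(\<Sum>i\<in>{1..<n-1} \<union> {n - 1, n}. f i) = (\<Sum>i = 1..<n-1. f i) + (f (n - 1) + f n)"
    using n by (subst sum.union_disjoint) auto
  also have "(\<Sum>i = 1..<n-1. f i) = 2 * (\<Sum>i = 1..<n-1. sqrt (increment i))"
    unfolding sum_distrib_left by (intro sum.cong refl) (auto simp: f_def)
  also have "real n * (2 * (\<Sum>i = 1..<n-1. sqrt (increment i)) + (f (n - 1) + f n))
      \<le> real n * (2 * sqrt (real n) + 2)"
    using n sum_sqrt_increment_le by (intro mult_left_mono add_mono) (auto simp: f_def)
  finally have f_sum: "(\<Sum>e\<in>vertex_pairs n. f (Min e)) \<le> real n * (2 + 2 * sqrt (real n))"
    by (simp add: add.commute)

  have "ln Z \<le> - (\<Sum>e\<in>vertex_pairs n. \<Sum>x\<in>A. w x * rel_ent (Q (Min e) e x) p)"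
    by (rule entropy_bound[where rank = Min and V = "vertex_pairs n" and w = w])
      (use sub ne p in \<open>auto simp: Z_def w_def Q_def fun_eq_iff\<close>)
  also have "\<dots> \<le> - (\<Sum>e\<in>vertex_pairs n. c + l * (t - f (Min e)))"
    unfolding ev_def[symmetric] neg_le_iff_le
  proof (rule sum_mono)
    fix e assume e: "e \<in> vertex_pairs n"
    have "c + l * (t - f (Min e)) \<le> c + l * ev (\<lambda>x. Q (Min e) e x ^ 3)"
      using cube[OF e] l by (intro add_left_mono mult_left_mono)
    also have "\<dots> = ev (\<lambda>x. c + l * Q (Min e) e x ^ 3)"
      by (simp add: ev_add ev_const ev_cmult)
    also have "\<dots> \<le> ev (\<lambda>x. rel_ent (Q (Min e) e x) p)"
      by (intro ev_mono tangent Q_bounds)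
    finally show "c + l * (t - f (Min e)) \<le> ev (\<lambda>x. rel_ent (Q (Min e) e x) p)" .
  qed
  also have "(\<Sum>e\<in>vertex_pairs n. c + l * (t - f (Min e)))
      = real (n choose 2) * (c + l * t) - l * (\<Sum>e\<in>vertex_pairs n. f (Min e))"
    by (simp add: sum.distrib right_diff_distrib sum_subtractf sum_distrib_left
        card_vertex_pairs algebra_simps)
  also have "- (real (n choose 2) * (c + l * t) - l * (\<Sum>e\<in>vertex_pairs n. f (Min e)))
      \<le> - real (n choose 2) * (c + l * t) + l * (real n * (2 + 2 * sqrt (real n)))"
    using mult_left_mono[OF f_sum l] by simp
  finally show ?thesis .
qed

end

section \<open>From the random graph to weighted edge sets\<close>

lemma prob_gnp:
  assumes p: "0 \<le> p" "p \<le> 1"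
  shows "measure_pmf.prob (gnp n p) {g. R g}
       = (\<Sum>x\<in>{x \<in> Pow (vertex_pairs n). R (\<lambda>e. e \<in> x)}. bweight p (vertex_pairs n) x)"
proof -
  let ?V = "vertex_pairs n" and ?F = "\<lambda>x e. e \<in> (x :: nat set set)"
  have supp: "set_pmf (gnp n p) \<subseteq> ?F ` Pow ?V"
  proof
    fix g assume "g \<in> set_pmf (gnp n p)"
    hence "\<And>e. e \<notin> ?V \<Longrightarrow> \<not> g e"
      using set_Pi_pmf_subset[of ?V False "\<lambda>_. bernoulli_pmf p"] by (auto simp: gnp_def)
    hence "{e. g e} \<in> Pow ?V" by auto
    moreover have "g = ?F {e. g e}" by simp
    ultimately show "g \<in> ?F ` Pow ?V" by (rule rev_image_eqI)
  qed
  have eq: "{g. R g} \<inter> ?F ` Pow ?V = ?F ` {x \<in> Pow ?V. R (?F x)}" by auto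
  have "measure_pmf.prob (gnp n p) {g. R g} = measure_pmf.prob (gnp n p) ({g. R g} \<inter> ?F ` Pow ?V)"
    using supp by (intro measure_prob_cong_0) (auto simp: set_pmf_eq)
  also have "\<dots> = (\<Sum>g\<in>?F ` {x \<in> Pow ?V. R (?F x)}. pmf (gnp n p) g)"
    unfolding eq by (rule measure_measure_pmf_finite) auto
  also have "\<dots> = (\<Sum>x\<in>{x \<in> Pow ?V. R (?F x)}. pmf (gnp n p) (?F x))"
    by (subst sum.reindex) (auto simp: inj_on_def fun_eq_iff)
  also have "\<dots> = (\<Sum>x\<in>{x \<in> Pow ?V. R (?F x)}. bweight p ?V x)"
  proof (intro sum.cong refl)
    fix x assume "x \<in> {x \<in> Pow ?V. R (?F x)}"
    hence "pmf (gnp n p) (?F x) = (\<Prod>e\<in>?V. pmf (bernoulli_pmf p) (e \<in> x))"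
      unfolding gnp_def by (intro pmf_Pi') auto
    also have "\<dots> = bweight p ?V x"
      unfolding bweight_def by (intro prod.cong refl) (use p in auto)
    finally show "pmf (gnp n p) (?F x) = bweight p ?V x" .
  qed
  finally show ?thesis .
qed

lemma num_triangles_eq_tri_count: "num_triangles n (\<lambda>e. e \<in> x) = tri_count n x"
proof -
  let ?S = "{(i, j, k). 1 \<le> i \<and> i < j \<and> j < k \<and> k \<le> n \<and> {i, j} \<in> x \<and> {j, k} \<in> x \<and> {i, k} \<in> x}"
  have "bij_betw (\<lambda>(i, j, k). {i, j, k}) ?S {U \<in> triples n. pairs U \<subseteq> x}"
    unfolding bij_betw_def
  proof
    show "inj_on (\<lambda>(i, j, k). {i, j, k}) ?S"
    proof (rule inj_onI)
      fix s s' assume "s \<in> ?S" "s' \<in> ?S"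
        and image_eq: "(case s of (i, j, k) \<Rightarrow> {i, j, k}) = (case s' of (i, j, k) \<Rightarrow> {i, j, k})"
      then obtain i j k i' j' k' where s: "s = (i, j, k)" "s' = (i', j', k')"
        and lt: "i < j" "j < k" "i' < j'" "j' < k'" by auto
      have eq: "{i, j, k} = {i', j', k'}" using image_eq by (simp add: s)
      have "i \<in> {i', j', k'}" "j \<in> {i', j', k'}" "k \<in> {i', j', k'}" unfolding eq[symmetric] by auto
      moreover have "i' \<in> {i, j, k}" "j' \<in> {i, j, k}" "k' \<in> {i, j, k}" unfolding eq by auto
      ultimately have "i = i' \<and> j = j' \<and> k = k'" using lt by auto
      thus "s = s'" by (simp add: s)
    qed
    show "(\<lambda>(i, j, k). {i, j, k}) ` ?S = {U \<in> triples n. pairs U \<subseteq> x}"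
    proof (intro equalityI subsetI)
      fix U assume "U \<in> (\<lambda>(i, j, k). {i, j, k}) ` ?S"
      then obtain i j k where "U = {i, j, k}" "1 \<le> i" "i < j" "j < k" "k \<le> n"
        "{i, j} \<in> x" "{j, k} \<in> x" "{i, k} \<in> x" by auto
      thus "U \<in> {U \<in> triples n. pairs U \<subseteq> x}" by (auto simp: triples_def pairs_triple)
    next
      fix U assume U: "U \<in> {U \<in> triples n. pairs U \<subseteq> x}"
      then obtain a b c where "U = {a, b, c}" "a \<noteq> b" "b \<noteq> c" "a \<noteq> c"
        by (auto simp: triples_def card_3_iff)
      then obtain i j k where ijk: "U = {i, j, k}" "i < j" "j < k"
        by (metis insert_commute linorder_neqE_nat)
      hence "(i, j, k) \<in> ?S" using U by (auto simp: triples_def pairs_triple)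
      thus "U \<in> (\<lambda>(i, j, k). {i, j, k}) ` ?S" using ijk(1) by (intro rev_image_eqI) auto
    qed
  qed
  from bij_betw_same_card[OF this] show ?thesis
    by (simp add: num_triangles_def tri_count_def)
qed

subsection \<open>Second moments\<close>

lemma sum_Pow_prod_if:
  fixes f g :: "'e \<Rightarrow> real"
  assumes "finite V"
  shows "(\<Sum>x\<in>Pow V. \<Prod>e\<in>V. if e \<in> x then f e else g e) = (\<Prod>e\<in>V. f e + g e)"
  unfolding prod_add[OF assms]
proof (intro sum.cong refl)
  fix x assume "x \<in> Pow V"
  hence "V \<inter> {e. e \<in> x} = x" "V \<inter> - {e. e \<in> x} = V - x" by auto
  thus "(\<Prod>e\<in>V. if e \<in> x then f e else g e) = prod f x * prod g (V - x)"
    using prod.If_cases[OF assms, of "\<lambda>e. e \<in> x" f g] by simp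
qed

text \<open>The indicator is absorbed into the product by giving weight 0 to the absence of each
  element of \<open>D\<close>; the product expansion then factorizes.\<close>

lemma bweight_moment:
  assumes V: "finite V" and D: "D \<subseteq> V"
  shows "(\<Sum>x\<in>Pow V. bweight p V x * of_bool (D \<subseteq> x)) = p ^ card D"
proof -
  let ?g = "\<lambda>e. if e \<in> D then 0 else 1 - p"
  have "bweight p V x * of_bool (D \<subseteq> x) = (\<Prod>e\<in>V. if e \<in> x then p else ?g e)" for x
  proof (cases "D \<subseteq> x")
    case True
    thus ?thesis unfolding bweight_def by (auto intro!: prod.cong)
  next
    case False
    then obtain d where "d \<in> D" "d \<notin> x" by auto
    hence "(\<Prod>e\<in>V. if e \<in> x then p else ?g e) = 0"
      using D V by (intro prod_zero) auto
    thus ?thesis using False by simp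
  qed
  hence "(\<Sum>x\<in>Pow V. bweight p V x * of_bool (D \<subseteq> x)) = (\<Prod>e\<in>V. p + ?g e)"
    using sum_Pow_prod_if[OF V, of "\<lambda>_. p" ?g] by simp
  also have "\<dots> = (\<Prod>e\<in>V. if e \<in> D then p else 1)" by (intro prod.cong) auto
  also have "\<dots> = p ^ card D"
    using D prod.If_cases[OF V, of "\<lambda>e. e \<in> D" "\<lambda>_. p" "\<lambda>_. 1"] by (simp add: Int_absorb1)
  finally show ?thesis .
qed

lemma bweight_sum: "finite V \<Longrightarrow> (\<Sum>x\<in>Pow V. bweight p V x) = 1"
  using bweight_moment[of V "{}" p] by simp

text \<open>Covariances vanish for disjoint \<open>D i\<close> and \<open>D j\<close> by
  independence and are at most 1 otherwise. The lemma serves the triangle count, with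
  \<open>D\<close> the edge sets of triples, and the edge count, with singletons.\<close>

lemma bweight_variance:
  assumes V: "finite V" and p: "0 < p" "p < 1" and I: "finite I" and D: "\<And>i. i \<in> I \<Longrightarrow> D i \<subseteq> V"
  shows "(\<Sum>x\<in>Pow V. bweight p V x * ((\<Sum>i\<in>I. of_bool (D i \<subseteq> x)) - (\<Sum>i\<in>I. p ^ card (D i)))\<^sup>2)
      \<le> real (card {(i, j) \<in> I \<times> I. D i \<inter> D j \<noteq> {}})"
proof -
  let ?X = "\<lambda>i x. of_bool (D i \<subseteq> x) :: real" and ?m = "\<lambda>i. p ^ card (D i)"
  have cov: "(\<Sum>x\<in>Pow V. bweight p V x * ((?X i x - ?m i) * (?X j x - ?m j)))
      \<le> of_bool (D i \<inter> D j \<noteq> {})" if ij: "i \<in> I" "j \<in> I" for i j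
  proof -
    have fin: "finite (D i)" "finite (D j)" using D ij V finite_subset by blast+
    have "(\<Sum>x\<in>Pow V. bweight p V x * ((?X i x - ?m i) * (?X j x - ?m j)))
      = (\<Sum>x\<in>Pow V. bweight p V x * of_bool (D i \<union> D j \<subseteq> x)
          - ?m i * (bweight p V x * ?X j x) - ?m j * (bweight p V x * ?X i x) + ?m i * ?m j * bweight p V x)"
      by (intro sum.cong refl) (auto simp: algebra_simps)
    also have "\<dots> = (\<Sum>x\<in>Pow V. bweight p V x * of_bool (D i \<union> D j \<subseteq> x))
        - ?m i * (\<Sum>x\<in>Pow V. bweight p V x * ?X j x) - ?m j * (\<Sum>x\<in>Pow V. bweight p V x * ?X i x)
        + ?m i * ?m j * (\<Sum>x\<in>Pow V. bweight p V x)"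
      by (simp only: sum.distrib sum_subtractf sum_distrib_left)
    also have "\<dots> = p ^ card (D i \<union> D j) - ?m i * ?m j"
      using bweight_moment[OF V Un_least[OF D[OF ij(1)] D[OF ij(2)]]]
      by (simp only: bweight_moment[OF V D[OF ij(1)]] bweight_moment[OF V D[OF ij(2)]] bweight_sum[OF V]) simp
    also have "\<dots> \<le> of_bool (D i \<inter> D j \<noteq> {})"
    proof (cases "D i \<inter> D j = {}")
      case True
      thus ?thesis using fin by (simp add: card_Un_disjoint power_add)
    next
      case False
      have "p ^ card (D i \<union> D j) \<le> 1" "0 \<le> ?m i * ?m j" using p by (auto intro: power_le_one)
      thus ?thesis using False by simp
    qed
    finally show ?thesis .
  qed
  have "(\<Sum>x\<in>Pow V. bweight p V x * ((\<Sum>i\<in>I. ?X i x) - (\<Sum>i\<in>I. ?m i))\<^sup>2)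
      = (\<Sum>x\<in>Pow V. \<Sum>i\<in>I. \<Sum>j\<in>I. bweight p V x * ((?X i x - ?m i) * (?X j x - ?m j)))"
    unfolding power2_eq_square sum_subtractf[symmetric] sum_product
    by (simp only: sum_distrib_left)
  also have "\<dots> = (\<Sum>i\<in>I. \<Sum>x\<in>Pow V. \<Sum>j\<in>I. bweight p V x * ((?X i x - ?m i) * (?X j x - ?m j)))"
    by (rule sum.swap)
  also have "\<dots> = (\<Sum>i\<in>I. \<Sum>j\<in>I. \<Sum>x\<in>Pow V. bweight p V x * ((?X i x - ?m i) * (?X j x - ?m j)))"
    by (intro sum.cong refl sum.swap)
  also have "\<dots> \<le> (\<Sum>i\<in>I. \<Sum>j\<in>I. of_bool (D i \<inter> D j \<noteq> {}))"
    by (intro sum_mono cov)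
  also have "\<dots> = (\<Sum>z\<in>I \<times> I. if D (fst z) \<inter> D (snd z) \<noteq> {} then 1 else 0)"
    unfolding sum.cartesian_product by (intro sum.cong refl) auto
  also have "\<dots> = (\<Sum>z\<in>{z \<in> I \<times> I. D (fst z) \<inter> D (snd z) \<noteq> {}}. 1)"
    using I by (intro sum.inter_filter[symmetric]) simp
  also have "\<dots> = real (card {(i, j) \<in> I \<times> I. D i \<inter> D j \<noteq> {}})"
    by (auto intro!: arg_cong[where f = card])
  finally show ?thesis .
qed

lemma finite_Chebyshev:
  fixes w f :: "'a \<Rightarrow> real"
  assumes S: "finite S" "\<And>x. x \<in> S \<Longrightarrow> 0 \<le> w x" and d: "0 < d"
  shows "(\<Sum>x\<in>{x \<in> S. d \<le> \<bar>f x\<bar>}. w x) \<le> (\<Sum>x\<in>S. w x * (f x)\<^sup>2) / d\<^sup>2"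
proof -
  have "(\<Sum>x\<in>{x \<in> S. d \<le> \<bar>f x\<bar>}. w x) * d\<^sup>2 = (\<Sum>x\<in>{x \<in> S. d \<le> \<bar>f x\<bar>}. w x * d\<^sup>2)"
    by (rule sum_distrib_right)
  also have "\<dots> \<le> (\<Sum>x\<in>{x \<in> S. d \<le> \<bar>f x\<bar>}. w x * (f x)\<^sup>2)"
    using S d by (intro sum_mono mult_left_mono) (auto simp: abs_le_square_iff[symmetric])
  also have "\<dots> \<le> (\<Sum>x\<in>S. w x * (f x)\<^sup>2)"
    using S by (intro sum_mono2) auto
  finally show ?thesis using d by (simp add: field_simps)
qed

text \<open>Two triples with a common edge are determined by that edge and one further vertex for
  each, that is by four vertices. This makes the standard deviation of the triangle count at most
  \<open>n ^ 2\<close>.\<close>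

lemma card_overlapping_triples:
  "card {(U, U') \<in> triples n \<times> triples n. pairs U \<inter> pairs U' \<noteq> {}} \<le> n ^ 4"
proof -
  let ?F = "\<lambda>(a, b, c, d). ({a, b, c}, {a, b, d})"
  let ?B = "{1..n} \<times> {1..n} \<times> {1..n} \<times> {1..n}"
  have third: "\<exists>c\<in>{1..n}. U = {a, b, c}" if U: "U \<in> triples n" and ab: "{a, b} \<subseteq> U" "a \<noteq> b" for U a b
  proof -
    have "card (U - {a, b}) = 1" using U ab by (simp add: triples_def card_Diff_subset)
    then obtain c where "U - {a, b} = {c}" by (auto simp: card_1_singleton_iff)
    moreover have "U \<subseteq> {1..n}" using U by (simp add: triples_def)
    ultimately show ?thesis using ab by blast
  qed
  have "{(U, U') \<in> triples n \<times> triples n. pairs U \<inter> pairs U' \<noteq> {}} \<subseteq> ?F ` ?B"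
  proof (clarify)
    fix U U' assume U: "U \<in> triples n" "U' \<in> triples n" and "pairs U \<inter> pairs U' \<noteq> {}"
    then obtain e where "e \<in> pairs U" "e \<in> pairs U'" by blast
    then obtain a b where ab: "a \<noteq> b" "{a, b} \<subseteq> U" "{a, b} \<subseteq> U'" by (auto simp: pairs_def card_2_iff)
    obtain c d where "c \<in> {1..n}" "U = {a, b, c}" "d \<in> {1..n}" "U' = {a, b, d}"
      using third[OF U(1) ab(2,1)] third[OF U(2) ab(3,1)] by blast
    moreover have "a \<in> {1..n}" "b \<in> {1..n}" using U(1) ab(2) by (auto simp: triples_def)
    ultimately show "(U, U') \<in> ?F ` ?B" by (intro image_eqI[where x = "(a, b, c, d)"]) auto
  qed
  hence "card {(U, U') \<in> triples n \<times> triples n. pairs U \<inter> pairs U' \<noteq> {}} \<le> card (?F ` ?B)"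
    by (intro card_mono) auto
  also have "\<dots> \<le> card ?B" by (rule card_image_le) simp
  also have "\<dots> = n ^ 4" by (simp add: card_cartesian_product power4_eq_xxxx)
  finally show ?thesis .
qed

section \<open>Binomial estimates, change of measure and the lower bound\<close>

lemma real_choose_2: "real (n choose 2) = real n * (real n - 1) / 2"
  by (induction n) (auto simp: numeral_2_eq_2 field_simps)

lemma real_choose_3: "real (n choose 3) = real n * (real n - 1) * (real n - 2) / 6"
proof (induction n)
  case (Suc n)
  have "Suc n choose 3 = (n choose 2) + (n choose 3)"
    by (simp add: numeral_3_eq_3 numeral_2_eq_2)
  hence "real (Suc n choose 3) = real (n choose 2) + real (n choose 3)" by simp
  thus ?case unfolding Suc.IH real_choose_2 by (simp add: field_simps)
qed simp

lemma real_choose_3_bounds: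
  assumes "4 \<le> n"
  shows "real n ^ 3 / 16 \<le> real (n choose 3)" "real (n choose 3) \<le> real n ^ 3 / 6"
proof -
  have n: "real n \<ge> 4" using assms by simp
  \<comment> \<open>The constant 16 comes from \<open>n - 1 \<ge> 3 n / 4\<close> and
    \<open>n - 2 \<ge> n / 2\<close> together with the denominator 6.\<close>
  have "real n * (3 * real n / 4) * (real n / 2) \<le> real n * (real n - 1) * (real n - 2)"
    using n by (intro mult_mono) auto
  thus "real n ^ 3 / 16 \<le> real (n choose 3)"
    by (simp add: real_choose_3 power3_eq_cube)
  have "real n * (real n - 1) * (real n - 2) \<le> real n * real n * real n"
    using n by (intro mult_mono) auto
  thus "real (n choose 3) \<le> real n ^ 3 / 6"
    by (simp add: real_choose_3 power3_eq_cube)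
qed

text \<open>The left side equals \<open>rel_ent r p - rel_ent r \<rho>\<close>. In the lower bound
  it is the log-likelihood cost per edge of tilting to \<open>\<rho>\<close>, evaluated at edge
  density \<open>r\<close>; the strict form with \<open>\<rho> = p\<close> gives positivity of the
  entropy.\<close>

lemma rel_ent_Gibbs:
  assumes "0 < p" "p < 1" "0 < r" "r < 1" "0 < \<rho>" "\<rho> < 1"
  shows "r * ln (\<rho> / p) + (1 - r) * ln ((1 - \<rho>) / (1 - p)) \<le> rel_ent r p"
    and "\<rho> \<noteq> r \<Longrightarrow> r * ln (\<rho> / p) + (1 - r) * ln ((1 - \<rho>) / (1 - p)) < rel_ent r p"
proof -
  let ?u = "\<rho> / r" and ?v = "(1 - \<rho>) / (1 - r)"
  have eq: "r * ln (\<rho> / p) + (1 - r) * ln ((1 - \<rho>) / (1 - p)) = rel_ent r p + (r * ln ?u + (1 - r) * ln ?v)"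
    using assms by (simp add: rel_ent_eq ln_div algebra_simps)
  have u: "r * ln ?u \<le> r * (?u - 1)"
    using assms by (intro mult_left_mono ln_le_minus_one) auto
  have v: "(1 - r) * ln ?v \<le> (1 - r) * (?v - 1)"
    using assms by (intro mult_left_mono ln_le_minus_one) auto
  have z: "r * (?u - 1) + (1 - r) * (?v - 1) = 0"
    using assms by (simp add: field_simps)
  show "r * ln (\<rho> / p) + (1 - r) * ln ((1 - \<rho>) / (1 - p)) \<le> rel_ent r p"
    unfolding eq using u v z by linarith
  assume "\<rho> \<noteq> r"
  hence "ln ?u \<noteq> ?u - 1" using ln_eq_minus_one[of ?u] assms by auto
  hence "ln ?u < ?u - 1" using ln_le_minus_one[of ?u] assms by auto
  hence "r * ln ?u < r * (?u - 1)" using assms by simp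
  thus "r * ln (\<rho> / p) + (1 - r) * ln ((1 - \<rho>) / (1 - p)) < rel_ent r p"
    unfolding eq using v z by linarith
qed

lemma rel_ent_pos:
  assumes "0 < p" "p < 1" "0 < r" "r \<le> 1" "r \<noteq> p"
  shows "0 < rel_ent r p"
proof (cases "r = 1")
  case True
  thus ?thesis using assms by (simp add: rel_ent_def)
next
  case False
  thus ?thesis using rel_ent_Gibbs(2)[of p r p] assms by simp
qed

lemma bweight_change:
  assumes V: "finite V" and x: "x \<subseteq> V" and p: "0 < p" "p < 1" "0 < \<rho>" "\<rho> < 1"
  shows "bweight p V x = bweight \<rho> V x * exp (- (real (card x) * ln (\<rho> / p)
      + (real (card V) - real (card x)) * ln ((1 - \<rho>) / (1 - p))))"
proof -
  let ?a = "ln (\<rho> / p)" and ?b = "ln ((1 - \<rho>) / (1 - p))"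
  have "V \<inter> {e. e \<in> x} = x" "V \<inter> - {e. e \<in> x} = V - x" using x by auto
  hence "(\<Sum>e\<in>V. if e \<in> x then ?a else ?b) = real (card x) * ?a + real (card (V - x)) * ?b"
    using sum.If_cases[OF V, of "\<lambda>e. e \<in> x" "\<lambda>_. ?a" "\<lambda>_. ?b"] by simp
  also have "real (card (V - x)) = real (card V) - real (card x)"
    using x V by (simp add: card_Diff_subset finite_subset of_nat_diff card_mono)
  finally have sum: "(\<Sum>e\<in>V. if e \<in> x then ?a else ?b)
      = real (card x) * ?a + (real (card V) - real (card x)) * ?b" .
  have "bweight p V x = (\<Prod>e\<in>V. (if e \<in> x then \<rho> else 1 - \<rho>) * exp (- (if e \<in> x then ?a else ?b)))"
    unfolding bweight_def using p by (intro prod.cong refl) (auto simp: exp_minus field_simps)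
  also have "\<dots> = bweight \<rho> V x * exp (- (\<Sum>e\<in>V. if e \<in> x then ?a else ?b))"
    by (simp add: prod.distrib bweight_def exp_sum[OF V] sum_negf[symmetric])
  finally show ?thesis unfolding sum .
qed

text \<open>The shift of the tilted density by \<open>1 / sqrt n\<close> lifts the mean triangle
  count above the threshold by order \<open>n powr (5/2)\<close>, well beyond its standard
  deviation, while adding only order \<open>n powr (3/2)\<close> edges to the cost. The first
  condition in \<open>nr\<close> keeps the tilted density away from 1; the second makes the two
  Chebyshev errors add up to at most 1/2.\<close>

lemma window_weight_ge:
  fixes n :: nat
  assumes p: "0 < p" "p < r" "r < 1" and n4: "4 \<le> n"
    and nr: "4 \<le> real n * (1 - r)\<^sup>2" "2 * (64 / r ^ 4 + 1) \<le> real n"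
  defines "W \<equiv> {x \<in> Pow (vertex_pairs n). real (n choose 3) * r ^ 3 \<le> real (tri_count n x) \<and>
      real (tri_count n x) \<le> real (n choose 3) * r ^ 3 + real n ^ 2 * sqrt (real n)}"
  shows "exp (- (real n ^ 2 * rel_ent r p / 2) - (3 / 2 * ln (2 / (p * (1 - r))) + 1) * (real n * sqrt (real n)))
      \<le> (\<Sum>x\<in>W. bweight p (vertex_pairs n) x)"
proof -
  define V where "V = vertex_pairs n"
  define \<sigma> where "\<sigma> = sqrt (real n)"
  define \<rho> where "\<rho> = r + 1 / \<sigma>"
  define C where "C = real (n choose 3)"
  define N where "N = real (n choose 2)"
  \<comment> \<open>The mean exceeds the threshold by at least \<open>3 * r ^ 2 / 16\<close> and at
    most \<open>1/2\<close> times \<open>real n ^ 2 * \<sigma>\<close>. The factor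
    \<open>r ^ 2 / 8\<close> therefore fits below the mean and leaves room above it; its square
    yields the 64 in the hypothesis.\<close>
  define \<delta> where "\<delta> = r\<^sup>2 / 8 * (real n ^ 2 * \<sigma>)"
  have V: "finite V" by (simp add: V_def)
  have r0: "0 < r" using p by simp
  have n0: "0 < real n" using n4 by simp
  have \<sigma>2: "\<sigma> * \<sigma> = real n" by (simp add: \<sigma>_def)
  have \<sigma>1: "1 \<le> \<sigma>" using n4 by (simp add: \<sigma>_def)
  have \<rho>: "0 < \<rho>" "\<rho> < 1" "r < \<rho>" "(1 - r) / 2 \<le> 1 - \<rho>"
  proof -
    have "2 \<le> \<sigma> * (1 - r)"
    proof (rule power2_le_imp_le)
      show "2\<^sup>2 \<le> (\<sigma> * (1 - r))\<^sup>2" using nr(1) \<sigma>2 by (simp add: power_mult_distrib power2_eq_square[of \<sigma>])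
    qed (use \<sigma>1 p in auto)
    hence "1 / \<sigma> \<le> (1 - r) / 2" using \<sigma>1 by (simp add: field_simps)
    moreover have "0 < 1 / \<sigma>" using \<sigma>1 by simp
    ultimately show "0 < \<rho>" "\<rho> < 1" "r < \<rho>" "(1 - r) / 2 \<le> 1 - \<rho>"
      unfolding \<rho>_def using p r0 by argo+
  qed
  have C: "real n ^ 3 / 16 \<le> C" "C \<le> real n ^ 3 / 6"
    unfolding C_def by (rule real_choose_3_bounds[OF n4])+
  have N: "N \<le> real n ^ 2 / 2" "0 \<le> N" "card V = n choose 2"
    using n0 by (auto simp: N_def real_choose_2 V_def card_vertex_pairs power2_eq_square)
  have n3: "real n ^ 3 * (1 / \<sigma>) = real n ^ 2 * \<sigma>"
    using \<sigma>1 by (simp add: field_simps \<sigma>2[symmetric] power2_eq_square power3_eq_cube)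
  have cube_diff: "3 * r\<^sup>2 * (1 / \<sigma>) \<le> \<rho> ^ 3 - r ^ 3" "\<rho> ^ 3 - r ^ 3 \<le> 3 * (1 / \<sigma>)"
  proof -
    have eq: "\<rho> ^ 3 - r ^ 3 = (\<rho>\<^sup>2 + \<rho> * r + r\<^sup>2) * (1 / \<sigma>)"
    proof -
      have "1 / \<sigma> = \<rho> - r" by (simp add: \<rho>_def)
      thus ?thesis by (simp only:) (simp add: power2_eq_square power3_eq_cube algebra_simps)
    qed
    have "r * r \<le> \<rho> * \<rho>" "r * r \<le> \<rho> * r" using \<rho> r0 by (auto intro: mult_mono)
    thus "3 * r\<^sup>2 * (1 / \<sigma>) \<le> \<rho> ^ 3 - r ^ 3"
      unfolding eq using \<sigma>1 by (intro mult_right_mono) (auto simp: power2_eq_square)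
    have "\<rho> * \<rho> \<le> 1" "\<rho> * r \<le> 1" "r * r \<le> 1" using \<rho> r0 p by (auto intro!: mult_le_one)
    thus "\<rho> ^ 3 - r ^ 3 \<le> 3 * (1 / \<sigma>)"
      unfolding eq using \<sigma>1 by (intro mult_right_mono) (auto simp: power2_eq_square)
  qed
  have gap_low: "C * r ^ 3 + \<delta> \<le> C * \<rho> ^ 3"
  proof -
    have "\<delta> \<le> 3 * r\<^sup>2 / 16 * (real n ^ 2 * \<sigma>)"
      unfolding \<delta>_def using \<sigma>1 by (intro mult_right_mono) auto
    also have "\<dots> = (real n ^ 3 / 16) * (3 * r\<^sup>2 * (1 / \<sigma>))"
      unfolding n3[symmetric] by simp
    also have "\<dots> \<le> C * (\<rho> ^ 3 - r ^ 3)"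
      using C(1) cube_diff(1) n0 \<sigma>1 order_trans[OF _ C(1), of 0] by (intro mult_mono) auto
    finally show ?thesis by (simp add: algebra_simps)
  qed
  have gap_high: "C * \<rho> ^ 3 + \<delta> \<le> C * r ^ 3 + real n ^ 2 * \<sigma>"
  proof -
    have "C * (\<rho> ^ 3 - r ^ 3) \<le> (real n ^ 3 / 6) * (3 * (1 / \<sigma>))"
    proof (intro mult_mono C cube_diff)
      have "0 \<le> 3 * r\<^sup>2 * (1 / \<sigma>)" using \<sigma>1 by simp
      thus "0 \<le> \<rho> ^ 3 - r ^ 3" using cube_diff(1) by linarith
    qed simp
    also have "\<dots> = real n ^ 2 * \<sigma> / 2" using n3 by simp
    finally have "C * (\<rho> ^ 3 - r ^ 3) \<le> real n ^ 2 * \<sigma> / 2" .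
    moreover have "\<delta> \<le> 1 / 2 * (real n ^ 2 * \<sigma>)"
      unfolding \<delta>_def using r0 p \<sigma>1 power_le_one[of r 2] by (intro mult_right_mono) auto
    ultimately show ?thesis by (simp add: algebra_simps)
  qed
  define B1 where "B1 = {x \<in> Pow V. \<delta> \<le> \<bar>real (tri_count n x) - C * \<rho> ^ 3\<bar>}"
  define B2 where "B2 = {x \<in> Pow V. real n * \<sigma> \<le> \<bar>real (card x) - N * \<rho>\<bar>}"
  define G where "G = Pow V - (B1 \<union> B2)"
  have nonneg: "0 \<le> bweight q V x" if "0 < q" "q < 1" for q x
    using bweight_pos[OF that, of V x] by simp
  have pairsV: "pairs U \<subseteq> V \<and> card (pairs U) = 3" if U: "U \<in> triples n" for U
  proof
    show "pairs U \<subseteq> V" using U by (auto simp: pairs_def triples_def V_def vertex_pairs_def)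
    have "finite U" using U by (auto simp: triples_def intro: card_ge_0_finite)
    thus "card (pairs U) = 3" using U n_subsets[of U 2]
      by (simp add: pairs_def triples_def numeral_3_eq_3 numeral_2_eq_2)
  qed
  have B1: "(\<Sum>x\<in>B1. bweight \<rho> V x) \<le> 64 / r ^ 4 / real n"
  proof -
    have "(\<Sum>x\<in>B1. bweight \<rho> V x) \<le> (\<Sum>x\<in>Pow V. bweight \<rho> V x * (real (tri_count n x) - C * \<rho> ^ 3)\<^sup>2) / \<delta>\<^sup>2"
      unfolding B1_def using V \<rho> n0 \<sigma>1 r0 by (intro finite_Chebyshev nonneg) (auto simp: \<delta>_def)
    also have "(\<Sum>x\<in>Pow V. bweight \<rho> V x * (real (tri_count n x) - C * \<rho> ^ 3)\<^sup>2)
       = (\<Sum>x\<in>Pow V. bweight \<rho> V x * ((\<Sum>U\<in>triples n. of_bool (pairs U \<subseteq> x)) - (\<Sum>U\<in>triples n. \<rho> ^ card (pairs U)))\<^sup>2)"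
      using pairsV by (simp add: tri_count_eq_sum C_def card_triples)
    also have "\<dots> \<le> real (card {(U, U') \<in> triples n \<times> triples n. pairs U \<inter> pairs U' \<noteq> {}})"
      using V \<rho> pairsV by (intro bweight_variance) auto
    also have "\<dots> \<le> real (n ^ 4)"
      by (rule of_nat_mono) (rule card_overlapping_triples)
    finally have "(\<Sum>x\<in>B1. bweight \<rho> V x) \<le> real (n ^ 4) / \<delta>\<^sup>2"
      using n0 by (simp add: divide_right_mono)
    also have "\<dots> = 64 / r ^ 4 / real n"
    proof -
      have \<delta>2: "\<delta>\<^sup>2 = r ^ 4 / 64 * (real n ^ 4 * real n)"
        unfolding \<delta>_def \<sigma>2[symmetric] by (simp add: power2_eq_square power4_eq_xxxx)
      show ?thesis unfolding \<delta>2 using n0 r0 by (simp add: field_simps)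
    qed
    finally show ?thesis .
  qed
  have B2: "(\<Sum>x\<in>B2. bweight \<rho> V x) \<le> 1 / real n"
  proof -
    have "(\<Sum>x\<in>B2. bweight \<rho> V x) \<le> (\<Sum>x\<in>Pow V. bweight \<rho> V x * (real (card x) - N * \<rho>)\<^sup>2) / (real n * \<sigma>)\<^sup>2"
      unfolding B2_def using V \<rho> n0 \<sigma>1 by (intro finite_Chebyshev nonneg) auto
    also have "(\<Sum>x\<in>Pow V. bweight \<rho> V x * (real (card x) - N * \<rho>)\<^sup>2)
       = (\<Sum>x\<in>Pow V. bweight \<rho> V x * ((\<Sum>e\<in>V. of_bool ({e} \<subseteq> x)) - (\<Sum>e\<in>V. \<rho> ^ card {e}))\<^sup>2)"
    proof (intro sum.cong refl)
      fix x assume "x \<in> Pow V"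
      hence "V \<inter> x = x" by auto
      hence "(\<Sum>e\<in>V. of_bool ({e} \<subseteq> x)) = real (card x)" using V by (simp add: Int_def[symmetric])
      thus "bweight \<rho> V x * (real (card x) - N * \<rho>)\<^sup>2
          = bweight \<rho> V x * ((\<Sum>e\<in>V. of_bool ({e} \<subseteq> x)) - (\<Sum>e\<in>V. \<rho> ^ card {e}))\<^sup>2"
        by (simp add: N_def N(3))
    qed
    also have "\<dots> \<le> real (card {(e, e') \<in> V \<times> V. {e} \<inter> {e'} \<noteq> {}})"
      using V \<rho> by (intro bweight_variance) auto
    also have "\<dots> \<le> real (card ((\<lambda>e. (e, e)) ` V))"
      using V by (intro of_nat_mono card_mono) auto
    also have "\<dots> \<le> real (card V)" using V by (intro of_nat_mono card_image_le)
    also have "\<dots> \<le> real n ^ 2"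
      unfolding N(3) N_def[symmetric] using N(1) zero_le_power2[of "real n"] by linarith
    finally have "(\<Sum>x\<in>B2. bweight \<rho> V x) \<le> real n ^ 2 / (real n * \<sigma>)\<^sup>2"
      using n0 by (simp add: divide_right_mono)
    also have "\<dots> = 1 / real n"
      using n0 \<sigma>1 by (simp add: power2_eq_square \<sigma>2[symmetric])
    finally show ?thesis .
  qed
  have G: "1 / 2 \<le> (\<Sum>x\<in>G. bweight \<rho> V x)"
  proof -
    have "(\<Sum>x\<in>B1 \<union> B2. bweight \<rho> V x) \<le> (\<Sum>x\<in>B1. bweight \<rho> V x) + (\<Sum>x\<in>B2. bweight \<rho> V x)"
      using V \<rho> by (subst sum.union_inter[symmetric])
        (auto simp: B1_def B2_def intro!: sum_nonneg nonneg)
    also have "\<dots> \<le> (64 / r ^ 4 + 1) / real n"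
      using B1 B2 by (simp add: add_divide_distrib)
    also have "\<dots> \<le> 1 / 2" using nr(2) n0 by (simp add: field_simps)
    finally have "(\<Sum>x\<in>B1 \<union> B2. bweight \<rho> V x) \<le> 1 / 2" .
    moreover have "(\<Sum>x\<in>G. bweight \<rho> V x) = 1 - (\<Sum>x\<in>B1 \<union> B2. bweight \<rho> V x)"
      unfolding G_def bweight_sum[OF V, of \<rho>, symmetric]
      using V by (intro sum_diff) (auto simp: B1_def B2_def)
    ultimately show ?thesis by linarith
  qed
  have GW: "G \<subseteq> W"
    unfolding G_def B1_def W_def V_def[symmetric] C_def[symmetric] \<sigma>_def[symmetric]
    using gap_low gap_high by (auto simp: abs_if split: if_splits)
  \<comment> \<open>This bounds the log odds ratio uniformly in \<open>n\<close>, using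
    \<open>\<rho> \<le> 1\<close> and \<open>1 - \<rho> \<ge> (1 - r) / 2\<close>.\<close>
  define \<kappa> where "\<kappa> = ln (2 / (p * (1 - r)))"
  have \<kappa>: "0 \<le> ln (\<rho> / p) - ln ((1 - \<rho>) / (1 - p))" "ln (\<rho> / p) - ln ((1 - \<rho>) / (1 - p)) \<le> \<kappa>"
  proof -
    have p1: "p < 1" using p by simp
    have "ln ((1 - \<rho>) / (1 - p)) \<le> 0" "0 \<le> ln (\<rho> / p)"
      using \<rho> p p1 by (auto intro!: ln_le_zero_iff[THEN iffD2])
    thus "0 \<le> ln (\<rho> / p) - ln ((1 - \<rho>) / (1 - p))" by simp
    have "ln (\<rho> / p) \<le> ln (1 / p)" using \<rho> p by (intro ln_mono) (auto simp: divide_right_mono)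
    moreover have "ln ((1 - r) / 2) \<le> ln ((1 - \<rho>) / (1 - p))"
    proof (rule ln_mono)
      have "1 - \<rho> \<le> (1 - \<rho>) / (1 - p)" using \<rho> p p1 by (simp add: field_simps)
      thus "(1 - r) / 2 \<le> (1 - \<rho>) / (1 - p)" using \<rho>(4) by linarith
    qed (use p in auto)
    moreover have "\<kappa> = ln (1 / p) - ln ((1 - r) / 2)"
      unfolding \<kappa>_def using p p1 by (simp add: ln_div ln_mult)
    ultimately show "ln (\<rho> / p) - ln ((1 - \<rho>) / (1 - p)) \<le> \<kappa>" by linarith
  qed
  have weight: "bweight \<rho> V x * exp (- (real n ^ 2 * rel_ent r p / 2) - 3 / 2 * \<kappa> * (real n * \<sigma>)) \<le> bweight p V x"
    if x: "x \<in> G" for x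
  proof -
    let ?a = "ln (\<rho> / p)" and ?b = "ln ((1 - \<rho>) / (1 - p))"
    have xV: "x \<subseteq> V" using x by (auto simp: G_def)
    have c1: "real (card x) \<le> N * \<rho> + real n * \<sigma>"
      using x by (auto simp: G_def B2_def abs_if split: if_splits)
    have c2: "N * \<rho> = N * r + N * (1 / \<sigma>)" by (simp add: \<rho>_def algebra_simps)
    have "N * (1 / \<sigma>) \<le> real n ^ 2 / 2 * (1 / \<sigma>)"
      using N \<sigma>1 by (intro mult_right_mono) auto
    also have "\<dots> = real n * \<sigma> / 2"
      using \<sigma>1 by (simp add: field_simps power2_eq_square \<sigma>2[symmetric])
    finally have card: "real (card x) - N * r \<le> 3 / 2 * (real n * \<sigma>)" using c1 c2 by argo
    \<comment> \<open>Centring the edge count at \<open>N * r\<close> instead of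
      \<open>N * \<rho>\<close> makes the main term an entropy at \<open>r\<close>. The excess of
      edges is only multiplied by the bounded log odds ratio.\<close>
    have "real (card x) * ?a + (N - real (card x)) * ?b
        = N * (r * ?a + (1 - r) * ?b) + (real (card x) - N * r) * (?a - ?b)"
      by (simp add: algebra_simps)
    also have "\<dots> \<le> real n ^ 2 / 2 * rel_ent r p + 3 / 2 * (real n * \<sigma>) * \<kappa>"
    proof (rule add_mono)
      have "N * (r * ?a + (1 - r) * ?b) \<le> N * rel_ent r p"
        using N p \<rho> by (intro mult_left_mono rel_ent_Gibbs) auto
      also have "\<dots> \<le> real n ^ 2 / 2 * rel_ent r p"
        using N rel_ent_pos[of p r] p by (intro mult_right_mono) auto
      finally show "N * (r * ?a + (1 - r) * ?b) \<le> real n ^ 2 / 2 * rel_ent r p" .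
      have "(real (card x) - N * r) * (?a - ?b) \<le> 3 / 2 * (real n * \<sigma>) * (?a - ?b)"
        using card \<kappa> by (intro mult_right_mono)
      also have "\<dots> \<le> 3 / 2 * (real n * \<sigma>) * \<kappa>"
        using \<kappa> \<sigma>1 by (intro mult_left_mono) auto
      finally show "(real (card x) - N * r) * (?a - ?b) \<le> 3 / 2 * (real n * \<sigma>) * \<kappa>" .
    qed
    finally have "- (real n ^ 2 * rel_ent r p / 2) - 3 / 2 * \<kappa> * (real n * \<sigma>)
        \<le> - (real (card x) * ?a + (real (card V) - real (card x)) * ?b)"
      by (simp add: N_def N(3) mult_ac)
    hence "bweight \<rho> V x * exp (- (real n ^ 2 * rel_ent r p / 2) - 3 / 2 * \<kappa> * (real n * \<sigma>))
        \<le> bweight \<rho> V x * exp (- (real (card x) * ?a + (real (card V) - real (card x)) * ?b))"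
      using nonneg \<rho> by (intro mult_left_mono) auto
    also have "\<dots> = bweight p V x"
      using \<rho> p by (intro bweight_change[symmetric] V xV) auto
    finally show ?thesis .
  qed
  \<comment> \<open>The additional \<open>1\<close> beside \<open>\<kappa>\<close> pays for the
    factor 1/2, the tilted mass that Chebyshev guarantees on \<open>G\<close>.\<close>
  have "exp (- (real n ^ 2 * rel_ent r p / 2) - (3 / 2 * \<kappa> + 1) * (real n * \<sigma>))
      = exp (- (real n * \<sigma>)) * exp (- (real n ^ 2 * rel_ent r p / 2) - 3 / 2 * \<kappa> * (real n * \<sigma>))"
    by (simp add: exp_add[symmetric] algebra_simps)
  also have "\<dots> \<le> 1 / 2 * exp (- (real n ^ 2 * rel_ent r p / 2) - 3 / 2 * \<kappa> * (real n * \<sigma>))"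
  proof (rule mult_right_mono)
    have "1 * 1 \<le> real n * \<sigma>" using n4 \<sigma>1 by (intro mult_mono) auto
    hence "2 \<le> exp (real n * \<sigma>)" using exp_ge_add_one_self[of "real n * \<sigma>"] by linarith
    thus "exp (- (real n * \<sigma>)) \<le> 1 / 2" by (simp add: exp_minus field_simps)
  qed simp
  also have "\<dots> \<le> (\<Sum>x\<in>G. bweight \<rho> V x) * exp (- (real n ^ 2 * rel_ent r p / 2) - 3 / 2 * \<kappa> * (real n * \<sigma>))"
    using G by (intro mult_right_mono) auto
  also have "\<dots> \<le> (\<Sum>x\<in>G. bweight p V x)"
    unfolding sum_distrib_right by (intro sum_mono weight)
  also have "\<dots> \<le> (\<Sum>x\<in>W. bweight p V x)"
    using GW V p by (intro sum_mono2 nonneg) (auto simp: W_def V_def)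
  finally show ?thesis by (simp add: \<kappa>_def \<sigma>_def V_def)
qed

subsection \<open>Tangents of the relative entropy as a function of the cube\<close>

definition rel_ent_deriv :: "real \<Rightarrow> real \<Rightarrow> real" where
  "rel_ent_deriv p q = ln (q / p) - ln ((1 - q) / (1 - p))"

text \<open>The slope of \<open>x \<mapsto> rel_ent (root 3 x) p\<close> at \<open>x = r ^ 3\<close>.\<close>

definition cube_slope :: "real \<Rightarrow> real \<Rightarrow> real" where
  "cube_slope p r = rel_ent_deriv p r / (3 * r\<^sup>2)"

lemma has_real_derivative_ln_ratio:
  assumes "0 < p" "p < 1" "0 < q" "q < 1"
  shows "((\<lambda>q. ln (q / p)) has_real_derivative 1 / q) (at q)"
    and "((\<lambda>q. ln ((1 - q) / (1 - p))) has_real_derivative - 1 / (1 - q)) (at q)"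
proof -
  have "((\<lambda>q. ln (q / p)) has_real_derivative 1 / (q / p) * (1 / p)) (at q)"
    using assms by (intro DERIV_chain2[OF DERIV_ln_divide] derivative_eq_intros) auto
  thus "((\<lambda>q. ln (q / p)) has_real_derivative 1 / q) (at q)" using assms by simp
  have "((\<lambda>q. ln ((1 - q) / (1 - p))) has_real_derivative
      1 / ((1 - q) / (1 - p)) * ((0 - 1) / (1 - p))) (at q)"
    using assms
    by (intro DERIV_chain2[OF DERIV_ln_divide] DERIV_cdivide DERIV_diff DERIV_const DERIV_ident) auto
  thus "((\<lambda>q. ln ((1 - q) / (1 - p))) has_real_derivative - 1 / (1 - q)) (at q)"
    using assms by simp
qed

lemma has_real_derivative_rel_ent:
  assumes "0 < p" "p < 1" "0 < q" "q < 1"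
  shows "((\<lambda>q. rel_ent q p) has_real_derivative rel_ent_deriv p q) (at q)"
proof -
  note d = has_real_derivative_ln_ratio[OF assms]
  have "((\<lambda>q. q * ln (q / p) + (1 - q) * ln ((1 - q) / (1 - p))) has_real_derivative
      (1 * ln (q / p) + 1 / q * q) + ((0 - 1) * ln ((1 - q) / (1 - p)) + - 1 / (1 - q) * (1 - q))) (at q)"
    by (intro DERIV_add DERIV_mult DERIV_diff DERIV_ident DERIV_const d)
  thus ?thesis unfolding rel_ent_eq rel_ent_deriv_def using assms by simp
qed

lemma has_real_derivative_rel_ent_deriv:
  assumes "0 < p" "p < 1" "0 < q" "q < 1"
  shows "(rel_ent_deriv p has_real_derivative 1 / q + 1 / (1 - q)) (at q)"
  unfolding rel_ent_deriv_def[abs_def]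
  using DERIV_diff[OF has_real_derivative_ln_ratio[OF assms]] by simp

lemma rel_ent_deriv_mono:
  assumes "0 < p" "p < 1" "0 < x" "x \<le> y" "y < 1"
  shows "rel_ent_deriv p x \<le> rel_ent_deriv p y"
  unfolding rel_ent_deriv_def using assms
  by (intro diff_mono ln_mono divide_right_mono divide_pos_pos) auto

lemma rel_ent_deriv_self: "0 < p \<Longrightarrow> p < 1 \<Longrightarrow> rel_ent_deriv p p = 0"
  by (simp add: rel_ent_deriv_def)

lemma rel_ent_self: "0 < p \<Longrightarrow> p < 1 \<Longrightarrow> rel_ent p p = 0"
  by (simp add: rel_ent_eq)

lemma rel_ent_mono:
  assumes "0 < p" "p \<le> x" "x \<le> y" "y < 1"
  shows "rel_ent x p \<le> rel_ent y p"
proof (rule DERIV_nonneg_imp_nondecreasing[OF assms(3)])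
  fix q assume q: "x \<le> q" "q \<le> y"
  have "0 \<le> rel_ent_deriv p q"
    using rel_ent_deriv_mono[of p p q] rel_ent_deriv_self[of p] assms q by simp
  thus "\<exists>d. ((\<lambda>x. rel_ent x p) has_real_derivative d) (at q) \<and> 0 \<le> d"
    using has_real_derivative_rel_ent[of p q] assms q by auto
qed

lemma rel_ent_nonneg:
  assumes "0 < p" "p < 1" "0 < q" "q \<le> 1"
  shows "0 \<le> rel_ent q p"
  using rel_ent_pos[OF assms] rel_ent_self[of p] assms by (cases "q = p") auto

lemma rel_ent_le_affine:
  assumes "0 < p" "p < 1" "0 < q" "q < 1"
  shows "rel_ent q p \<le> q * ln (1 / p) + (1 - q) * ln (1 / (1 - p))"
  unfolding rel_ent_eq using assms
  by (intro add_mono mult_left_mono ln_mono divide_right_mono) auto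

text \<open>The numerator of the derivative of the quotient is
  \<open>q * (1 / (1 - q) - 2 * rel_ent_deriv p q)\<close>. Thus \<open>h\<close> says that the
  slope in the coordinate \<open>q ^ 3\<close> increases, that is, convexity in this
  coordinate.\<close>

lemma slope_ratio_mono:
  assumes p: "0 < p" "p < 1" and xy: "0 < x" "x \<le> y" "y < 1"
    and h: "\<And>q. x \<le> q \<Longrightarrow> q \<le> y \<Longrightarrow> 2 * rel_ent_deriv p q \<le> 1 / (1 - q)"
  shows "rel_ent_deriv p x / x\<^sup>2 \<le> rel_ent_deriv p y / y\<^sup>2"
proof (rule DERIV_nonneg_imp_nondecreasing[OF xy(2)])
  fix q assume q: "x \<le> q" "q \<le> y"
  let ?D = "rel_ent_deriv p q"
  have q01: "0 < q" "q < 1" using q xy by auto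
  have "((\<lambda>q. rel_ent_deriv p q / q\<^sup>2) has_real_derivative
      ((1 / q + 1 / (1 - q)) * q\<^sup>2 - ?D * (2 * q)) / (q\<^sup>2 * q\<^sup>2)) (at q)"
    using q01 by (auto intro!: derivative_eq_intros has_real_derivative_rel_ent_deriv p)
  moreover have "(1 / q + 1 / (1 - q)) * q\<^sup>2 - ?D * (2 * q) = q * (1 / (1 - q) - 2 * ?D)"
    using q01 by (simp add: field_simps power2_eq_square)
  moreover have "0 \<le> q * (1 / (1 - q) - 2 * ?D) / (q\<^sup>2 * q\<^sup>2)"
    using q01 h[OF q] by (intro divide_nonneg_nonneg mult_nonneg_nonneg) auto
  ultimately show "\<exists>d. ((\<lambda>q. rel_ent_deriv p q / q\<^sup>2) has_real_derivative d) (at q) \<and> 0 \<le> d"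
    by (metis (no_types, lifting))
qed

text \<open>The entropy minus the slope times \<open>x ^ 3\<close> has derivative
  \<open>x ^ 2\<close> times the difference of the slope ratios at \<open>x\<close> and
  \<open>r\<close>, so it decreases before \<open>r\<close> and increases after it. Convexity on the
  segment alone is assumed, which makes the lemma usable where convexity fails elsewhere.\<close>

lemma tangent_segment:
  assumes p: "0 < p" "p < 1" and q: "0 < q" "q < 1" and r: "0 < r" "r < 1"
    and h: "\<And>x. min q r \<le> x \<Longrightarrow> x \<le> max q r \<Longrightarrow> 2 * rel_ent_deriv p x \<le> 1 / (1 - x)"
  shows "rel_ent r p + cube_slope p r * (q ^ 3 - r ^ 3) \<le> rel_ent q p"
proof -
  let ?K = "\<lambda>x. rel_ent x p - cube_slope p r * x ^ 3"
  let ?K' = "\<lambda>x. rel_ent_deriv p x - cube_slope p r * (3 * x\<^sup>2)"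
  have K: "(?K has_real_derivative ?K' x) (at x)" if "0 < x" "x < 1" for x
    using that by (auto intro!: derivative_eq_intros has_real_derivative_rel_ent p)
  have K'_eq: "?K' x = x\<^sup>2 * (rel_ent_deriv p x / x\<^sup>2 - rel_ent_deriv p r / r\<^sup>2)" if "0 < x" for x
    using that r by (simp add: cube_slope_def field_simps)
  have "?K r \<le> ?K q"
  proof (cases "q \<le> r")
    case True
    show ?thesis
    proof (rule DERIV_nonpos_imp_nonincreasing[OF True])
      fix x assume x: "q \<le> x" "x \<le> r"
      have "rel_ent_deriv p x / x\<^sup>2 \<le> rel_ent_deriv p r / r\<^sup>2"
        using x q r True by (intro slope_ratio_mono p h) auto
      hence "?K' x \<le> 0" using K'_eq[of x] x q by (simp add: mult_nonneg_nonpos)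
      thus "\<exists>d. (?K has_real_derivative d) (at x) \<and> d \<le> 0" using K[of x] x q r by auto
    qed
  next
    case False
    hence qr: "r \<le> q" by simp
    show ?thesis
    proof (rule DERIV_nonneg_imp_nondecreasing[OF qr])
      fix x assume x: "r \<le> x" "x \<le> q"
      have "rel_ent_deriv p r / r\<^sup>2 \<le> rel_ent_deriv p x / x\<^sup>2"
        using x q r qr by (intro slope_ratio_mono p h) auto
      hence "0 \<le> ?K' x" using K'_eq[of x] x r by simp
      thus "\<exists>d. (?K has_real_derivative d) (at x) \<and> 0 \<le> d" using K[of x] x q r by auto
    qed
  qed
  thus ?thesis by (simp add: algebra_simps)
qed

text \<open>Continuity of the entropy at 0 and 1, with its terms \<open>0 * ln 0\<close>, is
  avoided: the affine majorant of \<open>rel_ent_le_affine\<close> is continuous and agrees with the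
  entropy at both endpoints, so the limit is taken in the majorant.\<close>

lemma tangent_closure:
  assumes p: "0 < p" "p < 1"
    and le: "\<And>q. 0 < q \<Longrightarrow> q < 1 \<Longrightarrow> c + l * q ^ 3 \<le> rel_ent q p"
    and q: "0 \<le> q" "q \<le> 1"
  shows "c + l * q ^ 3 \<le> rel_ent q p"
proof -
  let ?G = "\<lambda>q. q * ln (1 / p) + (1 - q) * ln (1 / (1 - p)) - (c + l * q ^ 3)"
  have "0 \<le> ?G x" if "x \<in> closure {0<..<1::real}" for x
  proof (rule continuous_ge_on_closure[OF _ that])
    show "continuous_on (closure {0<..<1}) ?G" by (intro continuous_intros)
    fix x :: real assume "x \<in> {0<..<1}"
    thus "0 \<le> ?G x" using le[of x] rel_ent_le_affine[OF p, of x] by simp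
  qed
  hence G: "0 \<le> ?G x" if "0 \<le> x" "x \<le> 1" for x using that by simp
  consider "q = 0" | "q = 1" | "0 < q" "q < 1" using q by linarith
  thus ?thesis
  proof cases
    case 1
    thus ?thesis using G[of 0] by (simp add: rel_ent_eq)
  next
    case 2
    thus ?thesis using G[of 1] by (simp add: rel_ent_eq)
  qed (rule le)
qed

section \<open>Supporting tangents: large p, r near p, r near 1\<close>

definition supports_entropy :: "real \<Rightarrow> real \<Rightarrow> bool" where
  "supports_entropy p r \<longleftrightarrow>
     (\<forall>q. 0 \<le> q \<longrightarrow> q \<le> 1 \<longrightarrow> rel_ent r p + cube_slope p r * (q ^ 3 - r ^ 3) \<le> rel_ent q p)"

lemma supports_entropyI:
  assumes p: "0 < p" "p < 1"
    and le: "\<And>q. 0 < q \<Longrightarrow> q < 1 \<Longrightarrow> rel_ent r p + cube_slope p r * (q ^ 3 - r ^ 3) \<le> rel_ent q p"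
  shows "supports_entropy p r"
  unfolding supports_entropy_def
proof (intro allI impI)
  fix q :: real assume q: "0 \<le> q" "q \<le> 1"
  have "(rel_ent r p - cube_slope p r * r ^ 3) + cube_slope p r * q ^ 3 \<le> rel_ent q p"
  proof (rule tangent_closure[OF p _ q])
    fix q :: real assume "0 < q" "q < 1"
    from le[OF this] show "(rel_ent r p - cube_slope p r * r ^ 3) + cube_slope p r * q ^ 3 \<le> rel_ent q p"
      by (simp add: algebra_simps)
  qed
  thus "rel_ent r p + cube_slope p r * (q ^ 3 - r ^ 3) \<le> rel_ent q p"
    by (simp add: algebra_simps)
qed

text \<open>With \<open>y = q / (2 (1 - q))\<close> the bound at \<open>p = p_crit\<close> is exactly \<open>ln y \<le> y - 1\<close>.\<close>

lemma supports_entropy_above_p_crit: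
  assumes p: "p_crit < p" "p < 1" and r: "0 < r" "r < 1"
  shows "supports_entropy p r"
proof (rule supports_entropyI)
  have "0 < p_crit" unfolding p_crit_def by (intro divide_pos_pos add_pos_pos) auto
  with p show p0: "0 < p" by simp
  fix q :: real assume q: "0 < q" "q < 1"
  show "rel_ent r p + cube_slope p r * (q ^ 3 - r ^ 3) \<le> rel_ent q p"
  proof (rule tangent_segment[OF p0 p(2) q r])
    fix x assume "min q r \<le> x" "x \<le> max q r"
    hence x: "0 < x" "x < 1" using q r by auto
    let ?y = "x / (2 * (1 - x))"
    have "2 * (1 - p) / p \<le> exp (3 / 2)"
    proof -
      have "0 < 2 + exp (3 / 2 :: real)" by (intro add_pos_pos) auto
      hence "2 < p * (2 + exp (3 / 2))" using p(1) by (simp add: p_crit_def field_simps)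
      thus ?thesis using p0 by (simp add: field_simps)
    qed
    hence "ln (2 * (1 - p) / p) \<le> ln (exp (3 / 2))"
      using p0 p by (intro ln_mono) auto
    moreover have "rel_ent_deriv p x = ln ?y + ln (2 * (1 - p) / p)"
    proof -
      have "rel_ent_deriv p x = ln ((x / p) / ((1 - x) / (1 - p)))"
        unfolding rel_ent_deriv_def using x p0 p by (subst (3) ln_div) auto
      also have "(x / p) / ((1 - x) / (1 - p)) = ?y * (2 * (1 - p) / p)"
        using x p0 p by (simp add: divide_simps) (simp add: algebra_simps)
      also have "ln \<dots> = ln ?y + ln (2 * (1 - p) / p)"
        using x p0 p by (subst ln_mult) auto
      finally show ?thesis .
    qed
    moreover have "ln ?y \<le> ?y - 1" using x by (intro ln_le_minus_one) auto
    moreover have "1 / (1 - x) = 1 + 2 * ?y" using x by (simp add: field_simps)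
    ultimately show "2 * rel_ent_deriv p x \<le> 1 / (1 - x)" by simp
  qed
qed (use p in auto)

text \<open>The derivative of the entropy vanishes at \<open>p\<close>, so up to some
  \<open>u > p\<close> the convexity condition holds because \<open>1 / (1 - x) \<ge> 1\<close>.
  Beyond \<open>u\<close> the tangent is at most \<open>rel_ent r p + cube_slope p r\<close>, which
  tends to 0 as \<open>r\<close> approaches \<open>p\<close>, whereas the entropy stays above
  \<open>rel_ent u p > 0\<close>.\<close>

lemma supports_entropy_near_p:
  assumes p: "0 < p" "p < 1"
  obtains p' where "p < p'" "p' < 1" "\<And>r. p < r \<Longrightarrow> r < p' \<Longrightarrow> supports_entropy p r"
proof -
  have contD: "isCont (rel_ent_deriv p) p"
    using DERIV_isCont[OF has_real_derivative_rel_ent_deriv[OF p p]] .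
  hence "(rel_ent_deriv p \<longlongrightarrow> 0) (at p)"
    using rel_ent_deriv_self[OF p] by (simp add: isCont_def)
  hence "eventually (\<lambda>x. rel_ent_deriv p x < 1 / 2) (at p)"
    by (rule order_tendstoD) simp
  hence "eventually (\<lambda>x. rel_ent_deriv p x < 1 / 2) (at_right p)"
    by (rule filter_leD[OF at_le, rotated]) simp
  then obtain b where b: "p < b" "\<And>x. p < x \<Longrightarrow> x < b \<Longrightarrow> rel_ent_deriv p x < 1 / 2"
    unfolding eventually_at_right_field by auto
  define u where "u = (p + min b 1) / 2"
  have u: "p < u" "u < b" "u < 1" using b(1) p by (auto simp: u_def min_def field_simps)
  have below_u: "2 * rel_ent_deriv p x \<le> 1 / (1 - x)" if "0 < x" "x \<le> u" for x
  proof -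
    have "rel_ent_deriv p x \<le> rel_ent_deriv p u" using that u p by (intro rel_ent_deriv_mono) auto
    also have "\<dots> < 1 / 2" using u by (intro b(2))
    finally have "2 * rel_ent_deriv p x \<le> 1" by simp
    also have "1 \<le> 1 / (1 - x)" using that u by (simp add: field_simps)
    finally show ?thesis .
  qed
  have Iu: "0 < rel_ent u p" using rel_ent_pos[of p u] p u by simp
  have "isCont (\<lambda>r. rel_ent r p + cube_slope p r) p"
    unfolding cube_slope_def
    using DERIV_isCont[OF has_real_derivative_rel_ent[OF p p]] contD p
    by (intro continuous_intros) auto
  hence "((\<lambda>r. rel_ent r p + cube_slope p r) \<longlongrightarrow> 0) (at p)"
    using p by (simp add: isCont_def rel_ent_self rel_ent_deriv_self cube_slope_def)
  hence "eventually (\<lambda>r. rel_ent r p + cube_slope p r < rel_ent u p) (at p)"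
    by (rule order_tendstoD) (rule Iu)
  hence "eventually (\<lambda>r. rel_ent r p + cube_slope p r < rel_ent u p) (at_right p)"
    by (rule filter_leD[OF at_le, rotated]) simp
  then obtain d where d: "p < d" "\<And>r. p < r \<Longrightarrow> r < d \<Longrightarrow> rel_ent r p + cube_slope p r < rel_ent u p"
    unfolding eventually_at_right_field by auto
  show ?thesis
  proof (rule that[of "min u d"])
    fix r assume r: "p < r" "r < min u d"
    have slope: "0 \<le> cube_slope p r"
      unfolding cube_slope_def using rel_ent_deriv_mono[of p p r] rel_ent_deriv_self[OF p] p r u
      by (intro divide_nonneg_nonneg) auto
    show "supports_entropy p r"
    proof (rule supports_entropyI[OF p])
      fix q :: real assume q: "0 < q" "q < 1"
      show "rel_ent r p + cube_slope p r * (q ^ 3 - r ^ 3) \<le> rel_ent q p"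
      proof (cases "q \<le> u")
        case True
        show ?thesis
          by (rule tangent_segment[OF p q]) (use r u p q True in \<open>auto intro!: below_u\<close>)
      next
        case False
        have "q ^ 3 - r ^ 3 \<le> 1" using q r p power_le_one[of q 3] zero_le_power[of r 3] by linarith
        hence "cube_slope p r * (q ^ 3 - r ^ 3) \<le> cube_slope p r * 1"
          by (rule mult_left_mono) (rule slope)
        moreover have "rel_ent r p + cube_slope p r < rel_ent u p" using r by (intro d(2)) auto
        moreover have "rel_ent u p \<le> rel_ent q p" using False u q p by (intro rel_ent_mono) auto
        ultimately show ?thesis by linarith
      qed
    qed
  qed (use u d in auto)
qed

text \<open>On some interval from \<open>l\<close> to 1 convexity holds because
  \<open>rel_ent_deriv\<close> grows only like the logarithm of \<open>1 / (1 - x)\<close>. For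
  \<open>q\<close> below \<open>l\<close> the slope decides: it is unbounded as \<open>r\<close>
  approaches 1, so the tangent is already non-positive there.\<close>

lemma supports_entropy_near_1:
  assumes p: "0 < p" "p < 1"
  obtains p'' where "p'' < 1" "\<And>r. p'' < r \<Longrightarrow> r < 1 \<Longrightarrow> supports_entropy p r"
proof -
  \<comment> \<open>With \<open>y = 1 / (1 - x)\<close>, the estimates
    \<open>rel_ent_deriv p x \<le> ln (1 / p) + ln y\<close> and
    \<open>ln y \<le> y / 4 - 1 + ln 4\<close> reduce the goal to a linear lower bound on
    \<open>y\<close>, which \<open>Y\<close> meets. The summand \<open>1\<close> keeps
    \<open>Y\<close> positive.\<close>
  define Y where "Y = 4 * ln 4 + 4 * ln (1 / p) + 1"
  have "0 \<le> ln (4::real)" "0 \<le> ln (1 / p)" using p by auto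
  hence Y: "0 < Y" unfolding Y_def by linarith
  define l where "l = max p (1 - 1 / Y)"
  have l: "p \<le> l" "l < 1" using p Y by (auto simp: l_def)
  have above_l: "2 * rel_ent_deriv p x \<le> 1 / (1 - x)" if x: "l \<le> x" "x < 1" for x
  proof -
    define y where "y = 1 / (1 - x)"
    have x0: "0 < x" using x l p by simp
    have "1 - x \<le> 1 / Y" using x by (simp add: l_def)
    hence y: "Y \<le> y" using Y x by (simp add: y_def field_simps)
    have y0: "0 < y" using x by (simp add: y_def)
    have "rel_ent_deriv p x \<le> ln (1 / p) + ln y"
    proof -
      have "ln (x / p) \<le> ln (1 / p)" using x x0 p by (intro ln_mono divide_right_mono) auto
      moreover have "ln (1 - x) \<le> ln ((1 - x) / (1 - p))"
        using x p by (intro ln_mono) (auto simp: field_simps)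
      moreover have "ln y = - ln (1 - x)" using x by (simp add: y_def ln_div)
      ultimately show ?thesis by (simp add: rel_ent_deriv_def)
    qed
    moreover have "ln y \<le> y / 4 - 1 + ln 4"
    proof -
      have "ln (y / 4) \<le> y / 4 - 1" using y0 by (intro ln_le_minus_one) auto
      moreover have "ln (y / 4) = ln y - ln 4" using y0 by (subst ln_div) auto
      ultimately show ?thesis by linarith
    qed
    ultimately have "2 * rel_ent_deriv p x \<le> y" using y unfolding Y_def by argo
    thus ?thesis by (simp add: y_def)
  qed
  define l2 where "l2 = (1 + l) / 2"
  have l2: "l < l2" "l2 < 1" using l by (auto simp: l2_def)
  define \<eta> where "\<eta> = l2 ^ 3 - l ^ 3"
  have \<eta>: "0 < \<eta>" using power_strict_mono[of l l2 3] l l2 p by (simp add: \<eta>_def)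
  define B where "B = ln (1 / p) + ln (1 / (1 - p))"
  have lnp: "0 \<le> ln (1 / p)" "0 \<le> ln (1 / (1 - p))" using p by auto
  \<comment> \<open>This makes \<open>ln ((1 - p) / (1 - r)) \<ge> 3 * B / \<eta>\<close> for
    \<open>r > p''\<close>, hence a slope of at least \<open>B / \<eta>\<close>; the 3 is the one in
    \<open>cube_slope\<close>. Across a gap \<open>\<eta>\<close> between cubes the tangent then
    drops by at least \<open>B\<close>, which bounds the entropy at \<open>r\<close>.\<close>
  define p'' where "p'' = max l2 (1 - (1 - p) * exp (- (3 * B / \<eta>)))"
  show ?thesis
  proof (rule that[of p''])
    show "p'' < 1" using l2 p by (simp add: p''_def)
    fix r assume r: "p'' < r" "r < 1"
    have r0: "0 < r" "l2 < r" "p < r" using r l2 l p by (auto simp: p''_def)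
    have "1 - r \<le> (1 - p) * exp (- (3 * B / \<eta>))" using r by (simp add: p''_def)
    hence "exp (3 * B / \<eta>) \<le> (1 - p) / (1 - r)"
      using r by (simp add: exp_minus field_simps)
    hence "3 * B / \<eta> \<le> ln ((1 - p) / (1 - r))"
      using r p by (subst ln_ge_iff) auto
    also have "\<dots> = - ln ((1 - r) / (1 - p))" using r p by (simp add: ln_div)
    also have "\<dots> \<le> rel_ent_deriv p r" using r0 p by (simp add: rel_ent_deriv_def)
    finally have D: "3 * B / \<eta> \<le> rel_ent_deriv p r" .
    have D0: "0 \<le> rel_ent_deriv p r"
      using rel_ent_deriv_mono[of p p r] rel_ent_deriv_self[OF p] p r r0 by simp
    have "rel_ent_deriv p r / 3 \<le> cube_slope p r"
      unfolding cube_slope_def using D0 r0 r power_le_one[of r 2]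
      by (intro divide_left_mono) auto
    with D have slope: "B / \<eta> \<le> cube_slope p r" by simp
    have B0: "0 \<le> B" using lnp by (simp add: B_def)
    have IB: "rel_ent r p \<le> B"
    proof -
      have "rel_ent r p \<le> r * ln (1 / p) + (1 - r) * ln (1 / (1 - p))"
        using r r0 by (intro rel_ent_le_affine p)
      also have "\<dots> \<le> 1 * ln (1 / p) + 1 * ln (1 / (1 - p))"
        using r r0 lnp by (intro add_mono mult_right_mono) auto
      finally show ?thesis by (simp add: B_def)
    qed
    show "supports_entropy p r"
    proof (rule supports_entropyI[OF p])
      fix q :: real assume q: "0 < q" "q < 1"
      show "rel_ent r p + cube_slope p r * (q ^ 3 - r ^ 3) \<le> rel_ent q p"
      proof (cases "l \<le> q")
        case True
        show ?thesis
          by (rule tangent_segment[OF p q]) (use r r0 l2 q True in \<open>auto intro!: above_l\<close>)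
      next
        case False
        have "q ^ 3 \<le> l ^ 3" "l2 ^ 3 \<le> r ^ 3"
          using False q r0 l l2 p by (auto intro!: power_mono)
        hence gap: "\<eta> \<le> r ^ 3 - q ^ 3" by (simp add: \<eta>_def)
        have "B = B / \<eta> * \<eta>" using \<eta> by simp
        also have "\<dots> \<le> cube_slope p r * (r ^ 3 - q ^ 3)"
          using slope gap \<eta> B0 order_trans[OF _ slope, of 0] by (intro mult_mono) auto
        finally have "rel_ent r p + cube_slope p r * (q ^ 3 - r ^ 3) \<le> 0"
          using IB by (simp add: algebra_simps)
        also have "0 \<le> rel_ent q p" using q p by (intro rel_ent_nonneg) auto
        finally show ?thesis .
      qed
    qed
  qed
qed

subsection \<open>Assembling the estimates\<close>

text \<open>Since \<open>a > 0\<close>, dividing an additive error of order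
  \<open>n powr (3/2)\<close> by the main term \<open>n ^ 2 * a / 2\<close> gives the relative
  error. The witness solves the defining equation for \<open>\<epsilon> n\<close> exactly.\<close>

lemma exp_decayI:
  fixes P :: "nat \<Rightarrow> real"
  assumes a: "0 < a"
    and ev: "eventually (\<lambda>n. 0 < P n \<and> \<bar>ln (P n) + real n ^ 2 * a / 2\<bar> \<le> K * (real n * sqrt (real n))) sequentially"
  shows "exp_decay P a"
  unfolding exp_decay_def
proof (intro exI conjI)
  let ?e = "\<lambda>n. - 2 * ln (P n) / (real n ^ 2 * a) - 1"
  have pos: "eventually (\<lambda>n. 0 < n) sequentially" by (rule eventually_gt_at_top)
  show "?e \<in> O(\<lambda>n. real n powr (- 1 / 2))"
  proof (rule bigoI[where c = "2 * K / a"])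
    show "eventually (\<lambda>n. norm (?e n) \<le> 2 * K / a * norm (real n powr (- 1 / 2))) sequentially"
      using ev pos
    proof eventually_elim
      case (elim n)
      define \<sigma> where "\<sigma> = sqrt (real n)"
      have \<sigma>: "0 < \<sigma>" "\<sigma> * \<sigma> = real n" using elim by (simp_all add: \<sigma>_def)
      have e: "?e n = - (ln (P n) + real n ^ 2 * a / 2) * (2 / (real n ^ 2 * a))"
        using elim a by (simp add: field_simps)
      have "norm (?e n) = \<bar>ln (P n) + real n ^ 2 * a / 2\<bar> * (2 / (real n ^ 2 * a))"
        unfolding e real_norm_def abs_mult abs_minus_cancel using a by simp
      also have "\<dots> \<le> K * (real n * \<sigma>) * (2 / (real n ^ 2 * a))"
        using elim a by (intro mult_right_mono) (auto simp: \<sigma>_def)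
      also have "\<dots> = 2 * K / a * (1 / \<sigma>)"
        using \<sigma> a by (simp add: \<sigma>(2)[symmetric] field_simps power2_eq_square)
      also have "1 / \<sigma> = norm (real n powr (- 1 / 2))"
        by (simp add: \<sigma>_def powr_minus_divide powr_half_sqrt)
      finally show ?case .
    qed
  qed
  show "eventually (\<lambda>n. P n = exp (- (real n ^ 2 * a / 2) * (1 + ?e n))) sequentially"
    using ev pos
  proof eventually_elim
    case (elim n)
    have "- (real n ^ 2 * a / 2) * (1 + ?e n) = ln (P n)" using elim a by (simp add: field_simps)
    thus ?case using elim by simp
  qed
qed

lemma powr_five_halves: "real n powr (5 / 2) = real n ^ 2 * sqrt (real n)"
proof (cases "n = 0")
  case False
  have "real n powr (5 / 2) = real n powr (2 + 1 / 2)" by simp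
  also have "\<dots> = real n powr 2 * real n powr (1 / 2)" by (rule powr_add)
  also have "\<dots> = real n ^ 2 * sqrt (real n)" using False by (simp add: powr_half_sqrt)
  finally show ?thesis .
qed simp

lemma tri_count_le: "tri_count n x \<le> n choose 3"
  unfolding tri_count_def card_triples[symmetric] by (rule card_mono) auto

text \<open>Letting the triangle count fall short by \<open>n powr (5/2)\<close> covers the window
  as well as the tail: it lowers the triangle density by order \<open>n powr (-1/2)\<close>, within
  the admissible error.\<close>

lemma ln_weight_le:
  fixes n :: nat
  assumes pr: "0 < p" "p < r" "r < 1" and supp: "supports_entropy p r" and n: "4 \<le> n"
    and A: "A \<subseteq> Pow (vertex_pairs n)" "A \<noteq> {}"
    and sym: "\<And>\<pi> x. \<pi> permutes {1..n} \<Longrightarrow> x \<in> A \<Longrightarrow> (`) \<pi> ` x \<in> A"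
    and tri: "\<And>x. x \<in> A \<Longrightarrow> real (n choose 3) * r ^ 3 - real n ^ 2 * sqrt (real n) \<le> real (tri_count n x)"
  shows "ln (\<Sum>x\<in>A. bweight p (vertex_pairs n) x)
    \<le> - (real n ^ 2 * rel_ent r p / 2) + (rel_ent r p / 2 + 10 * cube_slope p r) * (real n * sqrt (real n))"
proof -
  interpret symmetric_event n p A
    by unfold_locales (use pr A sym in auto)
  define \<sigma> where "\<sigma> = sqrt (real n)"
  define C where "C = real (n choose 3)"
  define N where "N = real (n choose 2)"
  define l where "l = cube_slope p r"
  define I where "I = rel_ent r p"
  define t where "t = r ^ 3 - real n ^ 2 * \<sigma> / C"
  have n4: "4 \<le> real n" using n by simp
  have \<sigma>1: "1 \<le> \<sigma>" using n by (simp add: \<sigma>_def)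
  have C0: "0 < C" using n by (simp add: C_def zero_less_binomial)
  have l0: "0 \<le> l"
    unfolding l_def cube_slope_def using rel_ent_deriv_mono[of p p r] rel_ent_deriv_self[of p] pr
    by (intro divide_nonneg_nonneg) auto
  have I0: "0 \<le> I" unfolding I_def using pr by (intro rel_ent_nonneg) auto
  have t1: "t \<le> 1"
  proof -
    have "0 \<le> real n ^ 2 * \<sigma> / C" using C0 \<sigma>1 by simp
    thus ?thesis using pr power_le_one[of r 3] unfolding t_def by linarith
  qed
  have "ln Z \<le> - real (n choose 2) * ((I - l * r ^ 3) + l * t) + l * (real n * (2 + 2 * sqrt (real n)))"
  proof (rule ln_Z_le[OF _ l0 t1])
    fix q :: real assume "0 \<le> q" "q \<le> 1"
    hence "I + l * (q ^ 3 - r ^ 3) \<le> rel_ent q p"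
      using supp by (simp add: supports_entropy_def I_def l_def)
    thus "(I - l * r ^ 3) + l * q ^ 3 \<le> rel_ent q p" by (simp add: algebra_simps)
  next
    fix x assume "x \<in> A"
    moreover have "real (n choose 3) * t = real (n choose 3) * r ^ 3 - real n ^ 2 * sqrt (real n)"
      using C0 by (simp add: t_def C_def \<sigma>_def right_diff_distrib)
    ultimately show "real (n choose 3) * t \<le> real (tri_count n x)" using tri by simp
  qed (use n in simp)
  also have "\<dots> = - (N * I) + l * (N * (r ^ 3 - t)) + l * (2 * real n + 2 * (real n * \<sigma>))"
    by (simp add: N_def \<sigma>_def algebra_simps)
  \<comment> \<open>The three errors are \<open>I / 2\<close> from \<open>n choose 2\<close> against
    \<open>n ^ 2 / 2\<close>, then 6 from the density deficit \<open>3 n / (n - 2)\<close> with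
    \<open>n \<ge> 4\<close>, and 4 from the martingale losses.\<close>
  also have "\<dots> \<le> - (real n ^ 2 * I / 2) + (I / 2) * (real n * \<sigma>) + l * (6 * (real n * \<sigma>)) + l * (4 * (real n * \<sigma>))"
  proof (intro add_mono mult_left_mono l0)
    have "real n * 1 \<le> real n * \<sigma>" using \<sigma>1 by (intro mult_left_mono) auto
    thus "2 * real n + 2 * (real n * \<sigma>) \<le> 4 * (real n * \<sigma>)" by argo
    from \<open>real n * 1 \<le> real n * \<sigma>\<close> have "I / 2 * (real n * 1) \<le> I / 2 * (real n * \<sigma>)"
      using I0 \<sigma>1 by (intro mult_left_mono) auto
    moreover have "N * I = real n ^ 2 * I / 2 - I / 2 * (real n * 1)"
      by (simp add: N_def real_choose_2 power2_eq_square field_simps)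
    ultimately show "- (N * I) \<le> - (real n ^ 2 * I / 2) + I / 2 * (real n * \<sigma>)" by linarith
    have "N / C = 3 / (real n - 2)"
      using n4 by (simp add: N_def C_def real_choose_2 real_choose_3 divide_simps)
    hence "N * (r ^ 3 - t) = 3 / (real n - 2) * (real n * (real n * \<sigma>))"
      by (simp add: t_def power2_eq_square) (metis (no_types, lifting) mult.assoc times_divide_eq_left)
    also have "\<dots> = 3 * real n / (real n - 2) * (real n * \<sigma>)" by simp
    also have "\<dots> \<le> 6 * (real n * \<sigma>)"
      using n4 \<sigma>1 by (intro mult_right_mono) (auto simp: field_simps)
    finally show "N * (r ^ 3 - t) \<le> 6 * (real n * \<sigma>)" .
  qed
  also have "\<dots> = - (real n ^ 2 * I / 2) + (I / 2 + 10 * l) * (real n * \<sigma>)"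
    by (simp add: algebra_simps)
  finally show ?thesis by (simp add: Z_def I_def l_def \<sigma>_def)
qed

lemma act_in_Pow_vertex_pairs:
  assumes "\<pi> permutes {1..n}" "x \<subseteq> vertex_pairs n"
  shows "(`) \<pi> ` x \<subseteq> vertex_pairs n"
  using image_in_vertex_pairs[OF assms(1)] assms(2) by blast

text \<open>The event is sandwiched: it contains the window just above the threshold, whose
  probability is bounded below, and forces a count no more than \<open>n powr (5/2)\<close> below
  it. The tail and the window with constant 1 both qualify.\<close>

lemma exp_decay_of_events:
  fixes S :: "nat \<Rightarrow> nat \<Rightarrow> bool"
  assumes p: "0 < p" "p < r" "r < 1" and supp: "supports_entropy p r"
    and sub: "\<And>n t. real (n choose 3) * r ^ 3 \<le> real t \<Longrightarrow>
        real t \<le> real (n choose 3) * r ^ 3 + real n ^ 2 * sqrt (real n) \<Longrightarrow> S n t"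
    and sup: "\<And>n t. S n t \<Longrightarrow> real (n choose 3) * r ^ 3 - real n ^ 2 * sqrt (real n) \<le> real t"
  shows "exp_decay (\<lambda>n. measure_pmf.prob (gnp n p) {g. S n (num_triangles n g)}) (rel_ent r p)"
proof (rule exp_decayI)
  define I where "I = rel_ent r p"
  define \<kappa> where "\<kappa> = 3 / 2 * ln (2 / (p * (1 - r))) + 1"
  define K where "K = I / 2 + 10 * cube_slope p r"
  show I0: "0 < rel_ent r p" using p by (intro rel_ent_pos) auto
  have "eventually (\<lambda>n. 4 \<le> n \<and> 4 \<le> real n * (1 - r)\<^sup>2 \<and> 2 * (64 / r ^ 4 + 1) \<le> real n) sequentially"
  proof (intro eventually_conj eventually_ge_at_top)
    have *: "eventually (\<lambda>n. c \<le> real n) sequentially" for c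
      using filterlim_real_sequentially by (simp add: filterlim_at_top)
    show "eventually (\<lambda>n. 2 * (64 / r ^ 4 + 1) \<le> real n) sequentially" by (rule *)
    show "eventually (\<lambda>n. 4 \<le> real n * (1 - r)\<^sup>2) sequentially"
      using *[of "4 / (1 - r)\<^sup>2"] by eventually_elim (use p in \<open>simp add: field_simps\<close>)
  qed
  thus "eventually (\<lambda>n. 0 < measure_pmf.prob (gnp n p) {g. S n (num_triangles n g)} \<and>
      \<bar>ln (measure_pmf.prob (gnp n p) {g. S n (num_triangles n g)}) + real n ^ 2 * rel_ent r p / 2\<bar>
      \<le> max \<kappa> K * (real n * sqrt (real n))) sequentially"
  proof eventually_elim
    case (elim n)
    let ?V = "vertex_pairs n" and ?s = "real n * sqrt (real n)"
    define A where "A = {x \<in> Pow ?V. S n (tri_count n x)}"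
    define W where "W = {x \<in> Pow ?V. real (n choose 3) * r ^ 3 \<le> real (tri_count n x) \<and>
      real (tri_count n x) \<le> real (n choose 3) * r ^ 3 + real n ^ 2 * sqrt (real n)}"
    define P where "P = measure_pmf.prob (gnp n p) {g. S n (num_triangles n g)}"
    have P: "P = (\<Sum>x\<in>A. bweight p ?V x)"
      using prob_gnp[of p n "\<lambda>g. S n (num_triangles n g)"] p
      by (simp add: P_def A_def num_triangles_eq_tri_count)
    have "exp (- (real n ^ 2 * I / 2) - \<kappa> * ?s) \<le> (\<Sum>x\<in>W. bweight p ?V x)"
      unfolding W_def I_def \<kappa>_def using p elim by (intro window_weight_ge) auto
    also have "\<dots> \<le> P"
      unfolding P using p sub
      by (intro sum_mono2) (auto simp: A_def W_def intro!: less_imp_le[OF bweight_pos])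
    finally have low: "exp (- (real n ^ 2 * I / 2) - \<kappa> * ?s) \<le> P" .
    have P0: "0 < P" by (rule less_le_trans[OF exp_gt_zero low])
    have "- (real n ^ 2 * I / 2) - \<kappa> * ?s \<le> ln P" using low P0 by (simp add: ln_ge_iff)
    moreover have "ln P \<le> - (real n ^ 2 * I / 2) + K * ?s"
      unfolding P I_def K_def
    proof (rule ln_weight_le[OF p supp])
      show "A \<noteq> {}" using P0 P by auto
    qed (use elim in \<open>auto simp: A_def tri_count_act act_in_Pow_vertex_pairs sup\<close>)
    moreover have "\<kappa> * ?s \<le> max \<kappa> K * ?s" "K * ?s \<le> max \<kappa> K * ?s"
      by (intro mult_right_mono; simp)+
    ultimately show ?case using P0 unfolding P_def[symmetric] I_def[symmetric] by linarith
  qed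
qed

lemma exp_decay_upper_tail_window:
  assumes "0 < p" "p < r" "r < 1" and "supports_entropy p r"
  shows "exp_decay (upper_tail_prob p r) (rel_ent r p)" "exp_decay (window_prob p r 1) (rel_ent r p)"
proof -
  show "exp_decay (upper_tail_prob p r) (rel_ent r p)"
    unfolding upper_tail_prob_def[abs_def]
    by (rule exp_decay_of_events[OF assms]) (auto intro: order_trans[rotated])
  show "exp_decay (window_prob p r 1) (rel_ent r p)"
    unfolding window_prob_def[abs_def] powr_five_halves
    by (rule exp_decay_of_events[OF assms]) auto
qed

section \<open>The case r = 1\<close>

lemma tri_count_full_iff:
  assumes n: "3 \<le> n" and x: "x \<subseteq> vertex_pairs n"
  shows "tri_count n x = n choose 3 \<longleftrightarrow> x = vertex_pairs n"
proof
  assume "tri_count n x = n choose 3"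
  hence "card {U \<in> triples n. pairs U \<subseteq> x} = card (triples n)"
    by (simp add: tri_count_def card_triples)
  hence all: "{U \<in> triples n. pairs U \<subseteq> x} = triples n"
    by (intro card_subset_eq) auto
  have "e \<in> x" if e: "e \<in> vertex_pairs n" for e
  proof -
    have e2: "e \<subseteq> {1..n}" "card e = 2" "finite e" using e vertex_pairs_Min[OF e] by (auto simp: vertex_pairs_def)
    \<comment> \<open>Every edge lies in some triple because \<open>n \<ge> 3\<close> provides a
      third vertex, so a full triangle count forces every edge.\<close>
    have "\<not> {1..n} \<subseteq> e" using card_mono[OF e2(3), of "{1..n}"] e2(2) n by auto
    then obtain c where c: "c \<in> {1..n}" "c \<notin> e" by blast
    hence "insert c e \<in> triples n" using e2 by (simp add: triples_def)
    hence "pairs (insert c e) \<subseteq> x" using all by blast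
    thus ?thesis using e2(2) by (auto simp: pairs_def)
  qed
  thus "x = vertex_pairs n" using x by blast
next
  assume "x = vertex_pairs n"
  hence "{U \<in> triples n. pairs U \<subseteq> x} = triples n"
    by (auto simp: triples_def pairs_def vertex_pairs_def)
  thus "tri_count n x = n choose 3" by (simp add: tri_count_def card_triples)
qed

text \<open>At \<open>r = 1\<close> both events with window constant \<open>0\<close> are that the graph is complete. A positive
  window constant would add an entropy term of order \<open>n powr (3/2) * ln n\<close>.\<close>

lemma exp_decay_complete:
  assumes p: "0 < p" "p < 1"
  shows "exp_decay (upper_tail_prob p 1) (rel_ent 1 p)" "exp_decay (window_prob p 1 0) (rel_ent 1 p)"
proof -
  let ?a = "rel_ent 1 p"
  have a: "?a = ln (1 / p)" "0 < ?a" using p by (simp_all add: rel_ent_def)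
  have prob: "measure_pmf.prob (gnp n p) {g. R n (num_triangles n g)} = p ^ (n choose 2)"
    if n: "3 \<le> n" and R: "\<And>t. t \<le> n choose 3 \<Longrightarrow> R n t \<longleftrightarrow> t = n choose 3" for n and R :: "nat \<Rightarrow> nat \<Rightarrow> bool"
  proof -
    have "{x \<in> Pow (vertex_pairs n). R n (tri_count n x)} = {vertex_pairs n}"
      using tri_count_full_iff[OF n] R tri_count_le by auto
    thus ?thesis
      using prob_gnp[of p n "\<lambda>g. R n (num_triangles n g)"] p
      by (simp add: num_triangles_eq_tri_count bweight_def card_vertex_pairs)
  qed
  have decay: "exp_decay P ?a" if P: "\<And>n. 3 \<le> n \<Longrightarrow> P n = p ^ (n choose 2)" for P
  proof (rule exp_decayI[OF a(2), where K = "?a / 2"])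
    show "eventually (\<lambda>n. 0 < P n \<and> \<bar>ln (P n) + real n ^ 2 * ?a / 2\<bar> \<le> ?a / 2 * (real n * sqrt (real n))) sequentially"
      using eventually_ge_at_top[of 3]
    proof eventually_elim
      case (elim n)
      have "ln (P n) = - real (n choose 2) * ?a"
        using p by (simp add: P[OF elim] ln_realpow a(1) ln_div)
      hence "ln (P n) + real n ^ 2 * ?a / 2 = ?a / 2 * (real n * 1)"
        by (simp add: real_choose_2 power2_eq_square field_simps)
      moreover have "?a / 2 * (real n * 1) \<le> ?a / 2 * (real n * sqrt (real n))"
        using elim a(2) by (intro mult_left_mono) auto
      moreover have "0 \<le> ?a / 2 * (real n * 1)" using a(2) by simp
      ultimately have "\<bar>ln (P n) + real n ^ 2 * ?a / 2\<bar> \<le> ?a / 2 * (real n * sqrt (real n))"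
        by linarith
      moreover have "0 < P n" using p by (simp add: P[OF elim])
      ultimately show ?case by blast
    qed
  qed
  show "exp_decay (upper_tail_prob p 1) ?a"
    unfolding upper_tail_prob_def[abs_def]
    by (rule decay, rule prob[where R = "\<lambda>n t. real (n choose 3) * 1 ^ 3 \<le> real t"]) auto
  show "exp_decay (window_prob p 1 0) ?a"
    unfolding window_prob_def[abs_def]
    by (rule decay, rule prob[where R = "\<lambda>n t. \<bar>real t - real (n choose 3) * 1 ^ 3\<bar> \<le> 0 * real n powr (5 / 2)"]) auto
qed

theorem theorem7:
  fixes p :: real
  assumes "0 < p" and "p < 1"
  shows "(p > p_crit \<longrightarrow>
            (\<forall>r\<in>{p<..1}. exp_decay (upper_tail_prob p r) (rel_ent r p)) \<and>
            (\<forall>r\<in>{p<..1}. \<exists>C::real. exp_decay (window_prob p r C) (rel_ent r p))) \<and>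
         (p \<le> p_crit \<longrightarrow>
            (\<exists>p' p''. p < p' \<and> p' \<le> p'' \<and> p'' < 1 \<and>
              (\<forall>r\<in>{p<..<p'} \<union> {p''<..1}. exp_decay (upper_tail_prob p r) (rel_ent r p)) \<and>
              (\<forall>r\<in>{p<..<p'} \<union> {p''<..1}. \<exists>C::real. exp_decay (window_prob p r C) (rel_ent r p))))"
proof -
  have decay: "exp_decay (upper_tail_prob p r) (rel_ent r p) \<and>
      (\<exists>C. exp_decay (window_prob p r C) (rel_ent r p))"
    if "p < r" "r \<le> 1" "r < 1 \<Longrightarrow> supports_entropy p r" for r
  proof (cases "r = 1")
    case True
    thus ?thesis using exp_decay_complete[OF assms] by blast
  next
    case False
    hence "r < 1" using that(2) by simp
    thus ?thesis using exp_decay_upper_tail_window[OF assms(1) that(1) _ that(3)] by blast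
  qed
  obtain p1 where p1: "p < p1" "p1 < 1" "\<And>r. p < r \<Longrightarrow> r < p1 \<Longrightarrow> supports_entropy p r"
    using supports_entropy_near_p[OF assms] by blast
  obtain p2 where p2: "p2 < 1" "\<And>r. p2 < r \<Longrightarrow> r < 1 \<Longrightarrow> supports_entropy p r"
    using supports_entropy_near_1[OF assms] by blast
  show ?thesis
  proof (intro conjI impI)
    assume "p_crit < p"
    thus "\<forall>r\<in>{p<..1}. exp_decay (upper_tail_prob p r) (rel_ent r p)"
      and "\<forall>r\<in>{p<..1}. \<exists>C. exp_decay (window_prob p r C) (rel_ent r p)"
      using decay supports_entropy_above_p_crit assms by auto
  next
    have *: "exp_decay (upper_tail_prob p r) (rel_ent r p) \<and>
        (\<exists>C. exp_decay (window_prob p r C) (rel_ent r p))"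
      if "r \<in> {p<..<p1} \<union> {max p1 p2<..1}" for r
      by (rule decay) (use that p1 p2 in auto)
    show "\<exists>p' p''. p < p' \<and> p' \<le> p'' \<and> p'' < 1 \<and>
        (\<forall>r\<in>{p<..<p'} \<union> {p''<..1}. exp_decay (upper_tail_prob p r) (rel_ent r p)) \<and>
        (\<forall>r\<in>{p<..<p'} \<union> {p''<..1}. \<exists>C. exp_decay (window_prob p r C) (rel_ent r p))"
      \<comment> \<open>The two thresholds come from unrelated arguments, and
        \<open>max p1 p2\<close> enforces their order.\<close>
      by (rule exI[of _ p1], rule exI[of _ "max p1 p2"]) (use p1 p2 * in auto)
  qed
qed

end
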